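(* In the partial information model, there is a deterministic search algorithm for weighted search on $m$ rays whose competitive ratio is $O(\log m)$, and every deterministic search algorithm for weighted search on $m$ rays has competitive ratio $\Omega(\log m)$ in this model.
   Context: Weighted search on $m$ rays: a star consists of $m$ infinite rays $0,\dots,m-1$ with common origin $O$. An instance is $I=(W,(d_i,w_i)_{0\le i\le m-1})$ with $W\ge 0$, weights $w_i\ge 0$, distances $d_i\in[1,\infty]$, and $\sum_i w_i\ge W$; on ray $i$ a target of weight $w_i$ is hidden at distance $d_i$. A searcher starts at $O$. A (deterministic) search strategy chooses, each time the searcher is at $O$, a ray $r$ and depth $l_r$ (depending on what has been observed so far); the searcher walks along $r$ up to depth $l_r$ and back to $O$, except that on meeting the target of $r$ it immediately returns to $O$ and never searches $r$ again. The cost of a strategy on an instance is the total distance traversed until the discovered targets first have aggregate weight at least $W$. The online strategy has no knowledge of the instance. Partial information model: let $\Lambda=\{(d_i,w_i)\}_{0\le i\le m-1}$ be the multiset of distance–weight pairs of an instance; a presentation of $\Lambda$ is an assignment of its pairs to the rays, and each instance is a presentation of its multiset. An offline strategy knows $W$ and $\Lambda$ but not the presentation; its cost on $\Lambda$ is its worst-case cost over all presentations of $\Lambda$. The intrinsic cost $\xi(\Lambda)$ is the minimum of this worst-case cost over all offline strategies. The competitive ratio of an online strategy $\Sigma$ in this model is $\sup_I c(\Sigma,I)/\xi(\Lambda_I)$ over all instances $I$, where $\Lambda_I$ is the multiset of $I$. *)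

theory Defs
  imports "HOL-Library.Extended_Nonnegative_Real" "HOL-Library.Multiset" "HOL.Transcendental"
begin

text \<open>
  A target is a pair of a distance (possibly infinite) and a weight. A placement maps ray
  \<open>i < m\<close> to the target hidden on it; its values at arguments \<open>i \<ge> m\<close> are irrelevant.
\<close>

type_synonym target = "ennreal \<times> real"
type_synonym placement = "nat \<Rightarrow> target"

definition instances :: "nat \<Rightarrow> (real \<times> placement) set" where
  "instances m = {(W, p). 0 \<le> W \<and> (\<forall>i<m. 1 \<le> fst (p i) \<and> 0 \<le> snd (p i)) \<and> W \<le> (\<Sum>i<m. snd (p i))}"

text \<open>
  A trip \<open>(r, l, x)\<close> is one excursion from the origin: ray \<open>r\<close> was entered with depth bound
  \<open>l\<close>, and \<open>x\<close> is the target met on the way, if any. A strategy maps the list of past trips,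
  oldest first, to the next ray and depth. It has access to nothing else; knowledge of an
  instance is modelled by choosing the strategy in dependence on it.
\<close>

type_synonym trip = "nat \<times> real \<times> target option"
type_synonym strategy = "trip list \<Rightarrow> nat \<times> real"

definition found_rays :: "trip list \<Rightarrow> nat set" where
  "found_rays h = {r. \<exists>l t. (r, l, Some t) \<in> set h}"

text \<open>
  Once all \<open>m\<close> targets are found there is no legal ray left, and nothing is required: the
  collected weight is then at least \<open>W\<close> and the search is over.
\<close>

definition is_strategy :: "nat \<Rightarrow> strategy \<Rightarrow> bool" where
  "is_strategy m \<sigma> \<longleftrightarrow>
     (\<forall>h. \<not> {..<m} \<subseteq> found_rays h \<longrightarrow>
        (case \<sigma> h of (r, l) \<Rightarrow> r < m \<and> r \<notin> found_rays h \<and> 0 \<le> l))"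

fun make_trip :: "placement \<Rightarrow> nat \<times> real \<Rightarrow> trip" where
  "make_trip p (r, l) = (r, l, if fst (p r) \<le> ennreal l then Some (p r) else None)"

primrec history :: "strategy \<Rightarrow> placement \<Rightarrow> nat \<Rightarrow> trip list" where
  "history \<sigma> p 0 = []"
| "history \<sigma> p (Suc n) = history \<sigma> p n @ [make_trip p (\<sigma> (history \<sigma> p n))]"

fun reach :: "trip \<Rightarrow> ennreal" where
  "reach (r, l, None) = ennreal l"
| "reach (r, l, Some (d, w)) = d"

fun gain :: "trip \<Rightarrow> real" where
  "gain (r, l, None) = 0"
| "gain (r, l, Some (d, w)) = w"

definition collected :: "trip list \<Rightarrow> real" where
  "collected h = (\<Sum>t\<leftarrow>h. gain t)"

text \<open>
  All trips but the last are walked in both directions; the last one only up to its far end,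
  where the search stops.
\<close>

definition travelled :: "trip list \<Rightarrow> ennreal" where
  "travelled h = (if h = [] then 0 else (\<Sum>t\<leftarrow>butlast h. 2 * reach t) + reach (last h))"

text \<open>
  The cost is infinite if weight \<open>W\<close> is never reached, even if the trips have finite total length.
\<close>

definition cost :: "strategy \<Rightarrow> real \<Rightarrow> placement \<Rightarrow> ennreal" where
  "cost \<sigma> W p =
     (if \<exists>n. W \<le> collected (history \<sigma> p n)
      then travelled (history \<sigma> p (LEAST n. W \<le> collected (history \<sigma> p n)))
      else \<infinity>)"

definition target_mset :: "nat \<Rightarrow> placement \<Rightarrow> target multiset" where
  "target_mset m p = image_mset p (mset_set {..<m})"

definition presentations :: "target multiset \<Rightarrow> placement set" where
  "presentations \<Lambda> = {p. target_mset (size \<Lambda>) p = \<Lambda>}"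

definition intrinsic_cost :: "real \<Rightarrow> target multiset \<Rightarrow> ennreal" where
  "intrinsic_cost W \<Lambda> =
     (INF \<sigma>\<in>{\<sigma>. is_strategy (size \<Lambda>) \<sigma>}. SUP p\<in>presentations \<Lambda>. cost \<sigma> W p)"

text \<open>
  The degenerate quotients in \<^typ>\<open>ennreal\<close> are \<open>\<infinity> / \<infinity> = 0\<close> and \<open>0 / 0 = 0\<close>. The first
  occurs exactly when the targets at finite distance have total weight below \<open>W\<close>, so that no
  strategy can succeed; the second exactly when \<open>W = 0\<close>. Such instances thus do not affect
  the ratio.
\<close>

definition competitive_ratio :: "nat \<Rightarrow> strategy \<Rightarrow> ennreal" where
  "competitive_ratio m \<sigma> =
     (SUP (W, p)\<in>instances m. cost \<sigma> W p / intrinsic_cost W (target_mset m p))"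

end

theory Submission
  imports Defs "HOL-Combinatorics.Permutations"
begin

text \<open>
  Upper bound. The online searcher makes trips with depth bounds \<open>2 ^ i\<close> and always picks the level
  \<open>i\<close> minimizing \<open>V = S i + 2 ^ i\<close>, where \<open>S i\<close> is the distance already spent on level \<open>i\<close>, among
  the levels for which some unfound ray has not yet been explored to depth \<open>2 ^ i\<close>. Every level
  costs at most \<open>min V (m * 2 ^ i)\<close>, so that the total is \<open>O(V log m)\<close>. If the set \<open>F\<close> of targets
  found so far has insufficient weight and \<open>U\<close> is the set of the other targets, minimality of
  \<open>V\<close> gives
  \<open>V \<le> 2 (\<Sum>f\<in>F. min (d f) x) + 2 x (card {u \<in> U. d u > x} + 1)\<close> for each \<open>x\<close> exceeding some
  distance in \<open>U\<close>. An adversary that answers with targets of \<open>F\<close> as soon as possible turns this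
  into a bound \<open>V = O(\<xi>)\<close>: to force a target of \<open>U\<close>, an offline searcher must, for some such \<open>x\<close>,
  explore more rays to depth \<open>x\<close> than there are targets left beyond \<open>x\<close>.

  Lower bound. For \<open>k \<in> {1..m}\<close> let fewer than \<open>k\<close> rays be empty and let the others hold a
  target of weight 1 at distance \<open>m / k\<close>; with \<open>W = 1\<close>, exploring \<open>k\<close> rays costs at most
  \<open>2 m\<close>. An online searcher that finds nothing must, for every \<open>k\<close>, eventually explore \<open>k\<close> rays
  to depth \<open>m / k\<close>, and thus travel at least \<open>m\<close> times a harmonic sum.
\<close>

subsection \<open>Histories and costs\<close>

abbreviation total :: "trip list \<Rightarrow> ennreal" where
  "total h \<equiv> (\<Sum>t\<leftarrow>h. reach t)"

lemma travelled_snoc: "travelled (h @ [t]) = 2 * total h + reach t"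
  by (simp add: travelled_def sum_list_const_mult)

lemma total_le_travelled: "total h \<le> travelled h"
proof (cases h rule: rev_cases)
  case (snoc h' t)
  have "total h' \<le> 2 * total h'"
    by (simp add: mult_2)
  then show ?thesis by (simp add: snoc travelled_snoc add_right_mono)
qed (simp add: travelled_def)

lemma travelled_le_total: "travelled h \<le> 2 * total h"
proof (cases h rule: rev_cases)
  case (snoc h' t)
  have "reach t \<le> 2 * reach t"
    by (simp add: mult_2)
  then show ?thesis by (simp add: snoc travelled_snoc distrib_left add_left_mono)
qed (simp add: travelled_def)

lemma travelled_mono_history:
  "n \<le> n' \<Longrightarrow> travelled (history \<sigma> p n) \<le> travelled (history \<sigma> p n')"
proof (induction n' rule: dec_induct)
  case (step k)
  have "travelled (history \<sigma> p k) \<le> travelled (history \<sigma> p (Suc k))"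
    using travelled_le_total[of "history \<sigma> p k"]
    by (simp add: travelled_snoc add_increasing2)
  with step.IH show ?case by (rule order.trans)
qed simp

lemma collected_snoc: "collected (h @ [t]) = collected h + gain t"
  by (simp add: collected_def)

lemma gain_make_trip_nonneg: "(\<And>i. 0 \<le> snd (p i)) \<Longrightarrow> 0 \<le> gain (make_trip p z)"
  by (cases z; cases "p (fst z)") (auto, metis snd_conv)

lemma collected_mono_history:
  assumes "\<And>i. 0 \<le> snd (p i)" "n \<le> n'"
  shows "collected (history \<sigma> p n) \<le> collected (history \<sigma> p n')"
  using assms(2)
proof (induction n' rule: dec_induct)
  case (step k)
  then show ?case
    using gain_make_trip_nonneg[of p "\<sigma> (history \<sigma> p k)", OF assms(1)]
    by (simp add: collected_snoc)
qed simp

text \<open>The search is not over after \<open>n\<close> trips, so trip \<open>n + 1\<close> takes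
  place and everything up to its far end is paid for.\<close>

lemma cost_geI:
  assumes "\<And>i. 0 \<le> snd (p i)" "collected (history \<sigma> p n) < W"
    "T \<le> travelled (history \<sigma> p (Suc n))"
  shows "T \<le> cost \<sigma> W p"
proof (cases "\<exists>k. W \<le> collected (history \<sigma> p k)")
  case True
  define k where "k = (LEAST k. W \<le> collected (history \<sigma> p k))"
  have "W \<le> collected (history \<sigma> p k)"
    using True unfolding k_def by (rule LeastI_ex)
  then have "\<not> k \<le> n"
    using collected_mono_history[of p, OF assms(1), of k n \<sigma>] assms(2) by linarith
  then have "travelled (history \<sigma> p (Suc n)) \<le> travelled (history \<sigma> p k)"
    by (intro travelled_mono_history) simp
  with assms(3) True show ?thesis by (simp add: cost_def k_def)
qed (simp add: cost_def)

text \<open>The unfinished placement may change with \<open>n\<close>. If every search succeeded,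
  all would have succeeded by the largest of the finitely many success times, since collected weight
  never decreases.\<close>

lemma cost_infinite_if_never_all_collected:
  assumes "finite Q" "\<And>q i. q \<in> Q \<Longrightarrow> 0 \<le> snd (q i)"
    and slow: "\<And>n. \<exists>q\<in>Q. collected (history \<sigma> q n) < W"
  shows "\<exists>q\<in>Q. cost \<sigma> W q = \<infinity>"
proof (rule ccontr)
  assume "\<not> ?thesis"
  then have "\<forall>q\<in>Q. \<exists>n. W \<le> collected (history \<sigma> q n)"
    by (auto simp: cost_def split: if_splits)
  then obtain N where N: "\<And>q. q \<in> Q \<Longrightarrow> W \<le> collected (history \<sigma> q (N q))" by metis
  obtain q where q: "q \<in> Q" "collected (history \<sigma> q (Max (N ` Q))) < W" using slow by blast
  have "N q \<le> Max (N ` Q)" using \<open>finite Q\<close> q by simp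
  then show False
    using N[OF q(1)] q(2) collected_mono_history[of q, OF assms(2)[OF q(1)], of "N q" "Max (N ` Q)" \<sigma>]
    by simp
qed

lemma found_rays_simps:
  "found_rays [] = {}"
  "found_rays (h @ [(r, l, None)]) = found_rays h"
  "found_rays (h @ [(r, l, Some t)]) = insert r (found_rays h)"
  by (cases t; auto simp: found_rays_def)+

lemma finite_found_rays: "finite (found_rays h)"
proof (rule finite_subset)
  show "found_rays h \<subseteq> fst ` set h" by (force simp: found_rays_def)
qed simp

lemma strategy_legal:
  assumes "is_strategy m \<sigma>" "\<not> {..<m} \<subseteq> found_rays h" "\<sigma> h = (r, l)"
  shows "r < m" "r \<notin> found_rays h" "0 \<le> l"
  using assms by (auto simp: is_strategy_def)

text \<open>Legality keeps the searcher off rays already found, so no weight is counted twice. It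
  binds only while some ray is unfound, whence the hypothesis on all \<open>k < n\<close>.\<close>

lemma collected_eq_sum_found:
  assumes "is_strategy m \<sigma>" "\<forall>k<n. \<not> {..<m} \<subseteq> found_rays (history \<sigma> p k)"
  shows "found_rays (history \<sigma> p n) \<subseteq> {..<m} \<and>
    collected (history \<sigma> p n) = (\<Sum>r\<in>found_rays (history \<sigma> p n). snd (p r))"
  using assms(2)
proof (induction n)
  case (Suc n)
  obtain r l where rl: "\<sigma> (history \<sigma> p n) = (r, l)" by fastforce
  note legal = strategy_legal[OF assms(1) _ rl]
  obtain d w where dw: "p r = (d, w)" by fastforce
  from Suc legal show ?case
    by (auto simp: rl dw found_rays_simps collected_snoc finite_found_rays)
qed (simp add: found_rays_simps collected_def)

text \<open>Strong induction, because \<open>collected_eq_sum_found\<close> at time \<open>n\<close>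
  needs the claim at all earlier times.\<close>

lemma not_all_found:
  assumes "is_strategy m \<sigma>" "W \<le> (\<Sum>i<m. snd (p i))"
    "\<forall>k\<le>n. collected (history \<sigma> p k) < W"
  shows "\<not> {..<m} \<subseteq> found_rays (history \<sigma> p n)"
  using assms(3)
proof (induction n rule: less_induct)
  case (less n)
  then have "\<forall>k<n. \<not> {..<m} \<subseteq> found_rays (history \<sigma> p k)" by simp
  from collected_eq_sum_found[OF assms(1) this] less.prems assms(2) show ?case by auto
qed

subsection \<open>Matching rays with targets\<close>

lemma ex_descending_enumeration:
  fixes key :: "'a \<Rightarrow> 'b::linorder"
  assumes "finite A"
  obtains f where "bij_betw f {..<card A} A"
    "\<And>i j. i \<le> j \<Longrightarrow> j < card A \<Longrightarrow> key (f j) \<le> key (f i)"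
proof -
  obtain xs where xs: "set xs = A" "distinct xs" using finite_distinct_list[OF assms] by blast
  define ys where "ys = rev (sort_key key xs)"
  have ys: "set ys = A" "distinct ys" "length ys = card A"
    using xs distinct_card[of xs] by (auto simp: ys_def)
  have "bij_betw ((!) ys) {..<card A} A"
    using ys by (intro bij_betw_nth) auto
  moreover have "key (ys ! j) \<le> key (ys ! i)" if "i \<le> j" "j < card A" for i j
  proof -
    have "sorted (rev (map key ys))" by (simp add: ys_def rev_map)
    from sorted_rev_nth_mono[OF this that(1)] that ys(3) show ?thesis by simp
  qed
  ultimately show ?thesis using that by blast
qed

text \<open>
  If matching rays by descending depth with targets by descending distance fails at position \<open>j\<close>,
  then the first \<open>j\<close> rays already account for the stated sum.
\<close>

lemma matching_or_threshold:
  fixes y :: "'a \<Rightarrow> real" and d :: "'b \<Rightarrow> ennreal"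
  assumes fin: "finite R" "finite I" "card R = card I" and y: "\<And>r. r \<in> R \<Longrightarrow> 0 \<le> y r"
    and none: "\<nexists>b. bij_betw b R I \<and> (\<forall>r\<in>R. ennreal (y r) < d (b r))"
  obtains r i where "r \<in> R" "i \<in> I" "d i \<le> ennreal (y r)"
    "y r * (card {i\<in>I. ennreal (y r) < d i} + 1) \<le> sum y R"
proof -
  obtain f where f: "bij_betw f {..<card R} R"
    and f_mono: "\<And>i j. i \<le> j \<Longrightarrow> j < card R \<Longrightarrow> y (f j) \<le> y (f i)"
    by (rule ex_descending_enumeration[OF fin(1), of y]) blast
  obtain e where e: "bij_betw e {..<card R} I"
    and e_mono: "\<And>i j. i \<le> j \<Longrightarrow> j < card R \<Longrightarrow> d (e j) \<le> d (e i)"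
    unfolding fin(3) by (rule ex_descending_enumeration[OF fin(2), of d]) blast
  define b where "b = e \<circ> inv_into {..<card R} f"
  have "bij_betw b R I"
    unfolding b_def using bij_betw_inv_into[OF f] e by (rule bij_betw_trans)
  then obtain r where r: "r \<in> R" "\<not> ennreal (y r) < d (b r)" using none by blast
  define j where "j = inv_into {..<card R} f r"
  have j: "j < card R" "f j = r"
    using r f bij_betw_inv_into_right[OF f] bij_betw_apply[OF bij_betw_inv_into[OF f]]
    by (auto simp: j_def)
  have dj: "d (e j) \<le> ennreal (y r)" using r by (simp add: b_def j_def)
  \<comment> \<open>Distances descend along \<open>e\<close> and the one at position
    \<open>j\<close> is at most \<open>y r\<close>, so all farther targets come before
    \<open>j\<close>.\<close>
  have "{i\<in>I. ennreal (y r) < d i} \<subseteq> e ` {..<j}"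
  proof
    fix i assume i: "i \<in> {i\<in>I. ennreal (y r) < d i}"
    then obtain k where k: "k < card R" "i = e k" using e by (auto simp: bij_betw_def)
    have "\<not> j \<le> k" using e_mono[of j k] k dj i by force
    with k show "i \<in> e ` {..<j}" by auto
  qed
  then have "card {i\<in>I. ennreal (y r) < d i} \<le> card (e ` {..<j})"
    by (intro card_mono) auto
  also have "\<dots> \<le> j" using card_image_le[of "{..<j}" e] by simp
  finally have "card {i\<in>I. ennreal (y r) < d i} \<le> j" .
  then have "y r * (card {i\<in>I. ennreal (y r) < d i} + 1) \<le> y r * (j + 1)"
    using y[OF r(1)] by (intro mult_left_mono) auto
  also have "\<dots> = (\<Sum>i<Suc j. y r)" by simp
  \<comment> \<open>The \<open>j + 1\<close> rays at positions up to \<open>j\<close> are all at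
    least as deep as \<open>r\<close>.\<close>
  also have "\<dots> \<le> (\<Sum>i<Suc j. y (f i))"
    using f_mono j by (intro sum_mono) auto
  also have "\<dots> \<le> (\<Sum>i<card R. y (f i))"
    using j y bij_betw_apply[OF f] by (intro sum_mono2) auto
  also have "\<dots> = sum y R" by (rule sum.reindex_bij_betw[OF f])
  finally have "y r * (card {i\<in>I. ennreal (y r) < d i} + 1) \<le> sum y R" .
  with r(1) _ dj show ?thesis
  proof (rule that)
    show "e j \<in> I" using j(1) bij_betw_apply[OF e] by simp
  qed
qed

subsection \<open>Lower bounds on the intrinsic cost\<close>

lemma target_mset_permute:
  assumes "\<pi> permutes {..<m}"
  shows "target_mset m (p \<circ> \<pi>) = target_mset m p"
proof -
  have "image_mset \<pi> (mset_set {..<m}) = mset_set {..<m}"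
    using assms by (simp add: image_mset_mset_set permutes_inj_on permutes_image)
  then have "image_mset p (image_mset \<pi> (mset_set {..<m})) = image_mset p (mset_set {..<m})"
    by simp
  then show ?thesis by (simp add: target_mset_def multiset.map_comp)
qed

lemma permute_in_presentations:
  "\<pi> permutes {..<m} \<Longrightarrow> p \<circ> \<pi> \<in> presentations (target_mset m p)"
  using target_mset_permute[of \<pi> m p] by (simp add: presentations_def target_mset_def)

text \<open>
  \<open>F\<close> holds the targets the adversary is willing to give away; any other target would let the
  searcher succeed. A trip along \<open>r\<close> to depth \<open>l\<close> is answered by the nearest target of \<open>F\<close>
  not yet revealed, if its distance is at most \<open>l\<close>, and by nothing otherwise. Hence a ray that
  is still alive was never explored beyond any unrevealed target of \<open>F\<close>.
\<close>

locale revealing_adversary =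
  fixes m :: nat and W T :: real and p :: placement and F :: "nat set"
    and \<delta> :: "nat \<Rightarrow> real" and \<sigma> :: strategy
  assumes weight_nonneg: "\<And>i. 0 \<le> snd (p i)"
    and dist_ge_1: "\<And>i. i < m \<Longrightarrow> 1 \<le> fst (p i)"
    and F_subset: "F \<subseteq> {..<m}"
    and F_dist: "\<And>f. f \<in> F \<Longrightarrow> fst (p f) = ennreal (\<delta> f)"
    and \<delta>_ge_1: "\<And>f. f \<in> F \<Longrightarrow> 1 \<le> \<delta> f"
    and F_weight: "(\<Sum>f\<in>F. snd (p f)) < W"
    and W_le: "W \<le> (\<Sum>i<m. snd (p i))"
    and T_nonneg: "0 \<le> T"
    and threshold: "\<And>x. 1 \<le> x \<Longrightarrow> \<exists>u\<in>{..<m} - F. fst (p u) \<le> ennreal x \<Longrightarrow>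
      T < (\<Sum>f\<in>F. min (\<delta> f) x) + x * (card {u\<in>{..<m} - F. ennreal x < fst (p u)} + 1)"
    and strategy: "is_strategy m \<sigma>"
begin

lemma finite_F: "finite F"
  using F_subset finite_subset by blast

text \<open>
  In a state \<open>(A, g, y)\<close> the rays in \<open>A\<close> have been answered, ray \<open>r \<in> A\<close> by target \<open>g r\<close>, and
  every other ray \<open>r\<close> has been explored in vain to depth \<open>y r\<close>.
\<close>

definition compatible :: "nat set \<Rightarrow> (nat \<Rightarrow> nat) \<Rightarrow> (nat \<Rightarrow> real) \<Rightarrow> (nat \<Rightarrow> nat) \<Rightarrow> bool" where
  "compatible A g y \<pi> \<longleftrightarrow> \<pi> permutes {..<m} \<and> (\<forall>r\<in>A. \<pi> r = g r) \<and>
     (\<forall>r\<in>{..<m} - A. ennreal (y r) < fst (p (\<pi> r)))"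

definition spent :: "nat set \<Rightarrow> (nat \<Rightarrow> nat) \<Rightarrow> (nat \<Rightarrow> real) \<Rightarrow> real" where
  "spent A g y = (\<Sum>r\<in>A. \<delta> (g r)) + (\<Sum>r\<in>{..<m} - A. y r)"

text \<open>The strict inequality is the invariant kept by the adversary's answering rule; the
  budget \<open>T\<close> is what later collides with \<open>threshold\<close>.\<close>

definition admissible :: "nat set \<Rightarrow> (nat \<Rightarrow> nat) \<Rightarrow> (nat \<Rightarrow> real) \<Rightarrow> bool" where
  "admissible A g y \<longleftrightarrow> A \<subseteq> {..<m} \<and> inj_on g A \<and> g ` A \<subseteq> F \<and> (\<forall>r. 0 \<le> y r) \<and>
     (\<forall>r\<in>{..<m} - A. \<forall>f\<in>F - g ` A. y r < \<delta> f) \<and> spent A g y \<le> T"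

lemma spent_nonneg: "admissible A g y \<Longrightarrow> 0 \<le> spent A g y"
  unfolding admissible_def spent_def
  by (intro add_nonneg_nonneg sum_nonneg) (auto intro!: order.trans[OF zero_le_one \<delta>_ge_1])

lemma compatible_exists:
  assumes "admissible A g y"
  shows "\<exists>\<pi>. compatible A g y \<pi>"
proof (rule ccontr)
  assume none: "\<nexists>\<pi>. compatible A g y \<pi>"
  have A: "A \<subseteq> {..<m}" "inj_on g A" "g ` A \<subseteq> F" and y: "\<And>r. 0 \<le> y r"
    and ahead: "\<And>r f. r \<in> {..<m} - A \<Longrightarrow> f \<in> F - g ` A \<Longrightarrow> y r < \<delta> f"
    and spent: "spent A g y \<le> T"
    using assms by (auto simp: admissible_def)
  have [simp]: "finite A" "finite F" using A(1) finite_subset finite_F by auto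
  let ?R = "{..<m} - A" and ?I = "{..<m} - g ` A" and ?U = "{..<m} - F"
  have gA: "g ` A \<subseteq> {..<m}" using A F_subset by blast
  have card_eq: "card ?R = card ?I"
    using A gA by (simp add: card_Diff_subset card_image)
  have none': "\<nexists>b. bij_betw b ?R ?I \<and> (\<forall>r\<in>?R. ennreal (y r) < fst (p (b r)))"
  proof
    assume "\<exists>b. bij_betw b ?R ?I \<and> (\<forall>r\<in>?R. ennreal (y r) < fst (p (b r)))"
    then obtain b where b: "bij_betw b ?R ?I" "\<And>r. r \<in> ?R \<Longrightarrow> ennreal (y r) < fst (p (b r))"
      by blast
    define \<pi> where "\<pi> r = (if r \<in> A then g r else if r < m then b r else r)" for r
    have "bij_betw \<pi> (A \<union> ?R) (g ` A \<union> ?I)"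
    proof (rule bij_betw_combine)
      show "bij_betw \<pi> A (g ` A)"
        using inj_on_imp_bij_betw[OF A(2)] by (simp add: \<pi>_def cong: bij_betw_cong)
      show "bij_betw \<pi> ?R ?I"
        using b(1) by (rule bij_betw_cong[THEN iffD2, rotated]) (auto simp: \<pi>_def)
    qed auto
    moreover have "A \<union> ?R = {..<m}" "g ` A \<union> ?I = {..<m}" using A gA by auto
    ultimately have "bij_betw \<pi> {..<m} {..<m}" by simp
    then have "\<pi> permutes {..<m}"
      using A by (intro bij_imp_permutes) (auto simp: \<pi>_def)
    then have "compatible A g y \<pi>" using b(2) by (auto simp: compatible_def \<pi>_def)
    with none show False by blast
  qed
  obtain r i where ri: "r \<in> ?R" "i \<in> ?I" "fst (p i) \<le> ennreal (y r)"
    "y r * (card {i\<in>?I. ennreal (y r) < fst (p i)} + 1) \<le> sum y ?R"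
    by (rule matching_or_threshold[OF _ _ card_eq _ none']) (use y in auto)
  define x where "x = y r"
  have "1 \<le> ennreal x" unfolding x_def using order.trans[OF dist_ge_1[of i] ri(3)] ri(2) by simp
  then have x: "1 \<le> x" by (simp add: ennreal_le_iff2 flip: ennreal_1)
  have "i \<notin> F"
  proof
    assume "i \<in> F"
    then have "y r < \<delta> i" using ahead ri by blast
    then show False using ri(3) F_dist[OF \<open>i \<in> F\<close>] y[of r] by (simp add: ennreal_le_iff2)
  qed
  then have U: "\<exists>u\<in>?U. fst (p u) \<le> ennreal x" using ri by (auto simp: x_def)
  have split: "{i\<in>?I. ennreal x < fst (p i)} = (F - g ` A) \<union> {u\<in>?U. ennreal x < fst (p u)}"
    using A F_subset ahead[OF ri(1)] F_dist y by (auto simp: x_def ennreal_less_iff)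
  have card_split: "card {i\<in>?I. ennreal x < fst (p i)} =
      card (F - g ` A) + card {u\<in>?U. ennreal x < fst (p u)}"
    unfolding split by (rule card_Un_disjoint) auto
  have "T < (\<Sum>f\<in>F. min (\<delta> f) x) + x * (card {u\<in>?U. ennreal x < fst (p u)} + 1)"
    by (rule threshold[OF x U])
  also have "(\<Sum>f\<in>F. min (\<delta> f) x) = (\<Sum>f\<in>F - g ` A. min (\<delta> f) x) + (\<Sum>f\<in>g ` A. min (\<delta> f) x)"
    using A by (intro sum.subset_diff) auto
  also have "(\<Sum>f\<in>F - g ` A. min (\<delta> f) x) \<le> (\<Sum>f\<in>F - g ` A. x)" by (intro sum_mono) auto
  also have "(\<Sum>f\<in>g ` A. min (\<delta> f) x) \<le> (\<Sum>f\<in>g ` A. \<delta> f)" by (intro sum_mono) auto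
  also have "(\<Sum>f\<in>g ` A. \<delta> f) = (\<Sum>r\<in>A. \<delta> (g r))" using A by (simp add: sum.reindex)
  also have "(\<Sum>f\<in>F - g ` A. x) + (\<Sum>r\<in>A. \<delta> (g r)) + x * (card {u\<in>?U. ennreal x < fst (p u)} + 1)
      = (\<Sum>r\<in>A. \<delta> (g r)) + x * (card {i\<in>?I. ennreal x < fst (p i)} + 1)"
    unfolding card_split by (simp add: algebra_simps)
  also have "\<dots> \<le> spent A g y" using ri(4) by (simp add: spent_def x_def)
  finally show False using spent by simp
qed

text \<open>The searcher cannot tell the compatible placements apart: they all produce the same
  trips. \<open>spent\<close> is only a lower bound for the distance walked, since a ray entered
  repeatedly is charged once.\<close>

definition consistent :: "nat \<Rightarrow> trip list \<Rightarrow> nat set \<Rightarrow> (nat \<Rightarrow> nat) \<Rightarrow> (nat \<Rightarrow> real) \<Rightarrow> bool" where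
  "consistent n h A g y \<longleftrightarrow> admissible A g y \<and>
     (\<forall>\<pi>. compatible A g y \<pi> \<longrightarrow> history \<sigma> (p \<circ> \<pi>) n = h) \<and>
     ennreal (spent A g y) \<le> total h \<and> found_rays h = A \<and> collected h = (\<Sum>r\<in>A. snd (p (g r)))"

text \<open>Everything found belongs to \<open>F\<close>, which is too light. If all rays were
  found, \<open>F\<close> would contain all targets and have weight at least
  \<open>W\<close>.\<close>

lemma consistent_collected:
  assumes "consistent n h A g y"
  shows "collected h < W" "\<not> {..<m} \<subseteq> found_rays h"
proof -
  have A: "A \<subseteq> {..<m}" "inj_on g A" "g ` A \<subseteq> F" "found_rays h = A"
    and coll: "collected h = (\<Sum>r\<in>A. snd (p (g r)))"
    using assms by (auto simp: consistent_def admissible_def)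
  have "(\<Sum>r\<in>A. snd (p (g r))) = (\<Sum>f\<in>g ` A. snd (p f))" using A by (simp add: sum.reindex)
  also have "\<dots> \<le> (\<Sum>f\<in>F. snd (p f))"
    using A finite_F weight_nonneg by (intro sum_mono2) auto
  finally show "collected h < W" using F_weight coll by simp
  show "\<not> {..<m} \<subseteq> found_rays h"
  proof
    assume "{..<m} \<subseteq> found_rays h"
    then have "A = {..<m}" using A by auto
    then have "g ` A = {..<m}" using A F_subset
      by (metis card_image card_subset_eq finite_lessThan order.trans)
    then have "F = {..<m}" using A F_subset by auto
    then show False using F_weight W_le by simp
  qed
qed

lemma spent_upd:
  assumes "A \<subseteq> {..<m}" "r \<in> {..<m} - A"
  shows "spent A g (y(r := z)) = spent A g y - y r + z"
    "spent (insert r A) (g(r := f)) y = spent A g y - y r + \<delta> f"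
proof -
  have [simp]: "finite A" using assms finite_subset by blast
  show "spent A g (y(r := z)) = spent A g y - y r + z"
    using assms(2) sum.remove[of "{..<m} - A" r y] sum.remove[of "{..<m} - A" r "y(r := z)"]
    by (simp add: spent_def)
  have "{..<m} - insert r A = {..<m} - A - {r}" by auto
  moreover have "(\<Sum>x\<in>A. \<delta> (if x = r then f else g x)) = (\<Sum>x\<in>A. \<delta> (g x))"
    using assms by (intro sum.cong) auto
  ultimately show "spent (insert r A) (g(r := f)) y = spent A g y - y r + \<delta> f"
    using assms(2) sum.remove[of "{..<m} - A" r y]
    by (simp add: spent_def)
qed

text \<open>
  The last trip may overshoot the budget \<open>T\<close>. Stopping it at the depth \<open>l'\<close> where exactly \<open>T\<close> is
  spent leaves an admissible state, so the target on that ray can still be put beyond \<open>l'\<close>.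
\<close>

lemma costly_if_truncated:
  assumes cons: "consistent n h A g y" and rl: "\<sigma> h = (r, l)" and l: "l' < l" "y r \<le> l'"
    and ahead: "\<And>f. f \<in> F - g ` A \<Longrightarrow> l' < \<delta> f"
    and T: "spent A g y - y r + l' = T"
  shows "\<exists>\<pi>. \<pi> permutes {..<m} \<and> ennreal T \<le> cost \<sigma> W (p \<circ> \<pi>)"
proof -
  have adm: "admissible A g y" and A: "A \<subseteq> {..<m}" "found_rays h = A" and y: "\<And>r. 0 \<le> y r"
    and hist: "\<And>\<pi>. compatible A g y \<pi> \<Longrightarrow> history \<sigma> (p \<circ> \<pi>) n = h"
    and tot: "ennreal (spent A g y) \<le> total h"
    using cons by (auto simp: consistent_def admissible_def)
  note legal = strategy_legal[OF strategy consistent_collected(2)[OF cons] rl]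
  have r: "r \<in> {..<m} - A" using legal A by auto
  have l'_nonneg: "0 \<le> l'" using l y[of r] by simp
  then have "admissible A g (y(r := l'))"
    using adm ahead T spent_upd(1)[OF A(1) r, of g y l']
    unfolding admissible_def by simp
  then obtain \<pi> where \<pi>: "compatible A g (y(r := l')) \<pi>" using compatible_exists by blast
  have less': "ennreal ((y(r := l')) s) < fst (p (\<pi> s))" if "s \<in> {..<m} - A" for s
    using \<pi> that unfolding compatible_def by blast
  have less: "ennreal l' < fst (p (\<pi> r))" using less'[OF r] by simp
  have "compatible A g y \<pi>"
    unfolding compatible_def
  proof (intro conjI ballI)
    fix s assume s: "s \<in> {..<m} - A"
    have "ennreal (y s) \<le> ennreal ((y(r := l')) s)" using l by (intro ennreal_leI) simp
    then show "ennreal (y s) < fst (p (\<pi> s))" using less'[OF s] by (rule order.strict_trans1)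
  qed (use \<pi> in \<open>auto simp: compatible_def\<close>)
  from hist[OF this] have h: "history \<sigma> (p \<circ> \<pi>) n = h" .
  have "ennreal l' \<le> reach (make_trip (p \<circ> \<pi>) (r, l))"
    using less l by (cases "p (\<pi> r)") (auto simp: ennreal_leI)
  moreover have "ennreal T \<le> ennreal (spent A g y) + ennreal l'"
  proof -
    have "ennreal T \<le> ennreal (spent A g y + l')" using T y[of r] by (intro ennreal_leI) simp
    then show ?thesis using l'_nonneg spent_nonneg[OF adm] by (simp add: ennreal_plus)
  qed
  ultimately have "ennreal T \<le> total h + reach (make_trip (p \<circ> \<pi>) (r, l))"
    using add_mono[OF tot] order.trans by blast
  also have "\<dots> = total (h @ [make_trip (p \<circ> \<pi>) (r, l)])"
    by (simp del: make_trip.simps)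
  also have "\<dots> \<le> travelled (h @ [make_trip (p \<circ> \<pi>) (r, l)])"
    by (rule total_le_travelled)
  also have "h @ [make_trip (p \<circ> \<pi>) (r, l)] = history \<sigma> (p \<circ> \<pi>) (Suc n)"
    by (simp add: h rl)
  finally have "ennreal T \<le> cost \<sigma> W (p \<circ> \<pi>)"
    using weight_nonneg h consistent_collected(1)[OF cons] by (intro cost_geI) auto
  then show ?thesis using \<pi> by (auto simp: compatible_def)
qed

text \<open>The next trip is answered by the adversary's rule. The budget survives, because
  exceeding it would make some presentation cost at least \<open>T\<close> by
  \<open>costly_if_truncated\<close>.\<close>

lemma consistent_step:
  assumes cons: "consistent n h A g y"
    and cheap: "\<And>\<pi>. \<pi> permutes {..<m} \<Longrightarrow> cost \<sigma> W (p \<circ> \<pi>) < ennreal T"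
  shows "\<exists>h A g y. consistent (Suc n) h A g y"
proof -
  have adm: "admissible A g y" and A: "A \<subseteq> {..<m}" "found_rays h = A" "inj_on g A" "g ` A \<subseteq> F"
    and y: "\<And>r. 0 \<le> y r"
    and ahead: "\<And>r f. r \<in> {..<m} - A \<Longrightarrow> f \<in> F - g ` A \<Longrightarrow> y r < \<delta> f"
    and hist: "\<And>\<pi>. compatible A g y \<pi> \<Longrightarrow> history \<sigma> (p \<circ> \<pi>) n = h"
    and tot: "ennreal (spent A g y) \<le> total h"
    and coll: "collected h = (\<Sum>r\<in>A. snd (p (g r)))"
    and le_T: "spent A g y \<le> T"
    using cons by (auto simp: consistent_def admissible_def)
  have [simp]: "finite A" using A finite_subset by blast
  obtain r l where rl: "\<sigma> h = (r, l)" by fastforce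
  note legal = strategy_legal[OF strategy consistent_collected(2)[OF cons] rl]
  have r: "r \<in> {..<m} - A" using legal A by auto
  note spent_nonneg = spent_nonneg[OF adm]
  have not_truncated: False
    if "l' < l" "y r \<le> l'" "\<And>f. f \<in> F - g ` A \<Longrightarrow> l' < \<delta> f" "spent A g y - y r + l' = T" for l'
    using costly_if_truncated[OF cons rl that] cheap by (meson not_le)
  show ?thesis
  proof (cases "\<exists>f\<in>F - g ` A. \<delta> f \<le> l")
    case True
    \<comment> \<open>With the nearest target, a trip truncated before \<open>\<delta> f\<close>
      stops short of every unrevealed target of \<open>F\<close>, as the truncation argument
      requires.\<close>
    define f where "f = arg_min_on \<delta> (F - g ` A)"
    have ne: "finite (F - g ` A)" "F - g ` A \<noteq> {}" using finite_F True by auto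
    have f: "f \<in> F - g ` A" using arg_min_if_finite(1)[OF ne] by (simp add: f_def)
    have f_min: "\<delta> f \<le> \<delta> f'" if "f' \<in> F - g ` A" for f'
      using arg_min_least[OF ne that] by (simp add: f_def)
    have f_le: "\<delta> f \<le> l" using True f_min by force
    have new_le: "spent A g y - y r + \<delta> f \<le> T"
    proof (rule ccontr)
      assume "\<not> ?thesis"
      then show False
        using f_le f_min le_T by (intro not_truncated[of "T - spent A g y + y r"]) force+
    qed
    let ?h = "h @ [(r, l, Some (p f))]" and ?A = "insert r A" and ?g = "g(r := f)"
    have im: "?g ` ?A = insert f (g ` A)" using r by auto
    have "admissible ?A ?g y"
      using A r f ahead y new_le spent_upd(2)[OF A(1) r, of g f y]
      unfolding admissible_def im by (auto simp: inj_on_def)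
    moreover have "history \<sigma> (p \<circ> \<pi>) (Suc n) = ?h" if \<pi>: "compatible ?A ?g y \<pi>" for \<pi>
    proof -
      have \<pi>r: "\<pi> r = f" using \<pi> by (auto simp: compatible_def)
      have "compatible A g y \<pi>"
        unfolding compatible_def
      proof (intro conjI ballI)
        fix s assume s: "s \<in> {..<m} - A"
        show "ennreal (y s) < fst (p (\<pi> s))"
        proof (cases "s = r")
          case True
          then show ?thesis using ahead[OF r f] y f F_dist[of f] \<pi>r by (simp add: ennreal_less_iff)
        qed (use s \<pi> in \<open>auto simp: compatible_def\<close>)
      qed (use \<pi> r in \<open>auto simp: compatible_def\<close>)
      from hist[OF this] show ?thesis
        using f f_le F_dist[of f] by (simp add: rl \<pi>r ennreal_leI)
    qed
    moreover have "ennreal (spent ?A ?g y) \<le> total ?h"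
    proof -
      have "ennreal (spent ?A ?g y) \<le> ennreal (spent A g y + \<delta> f)"
        using spent_upd(2)[OF A(1) r, of g f y] y[of r] by (intro ennreal_leI) simp
      also have "\<dots> = ennreal (spent A g y) + fst (p f)"
        using f F_dist[of f] \<delta>_ge_1[of f] spent_nonneg by (simp add: ennreal_plus)
      also have "\<dots> \<le> total h + fst (p f)" using tot by (rule add_right_mono)
      finally show ?thesis by (cases "p f") simp
    qed
    moreover have "collected ?h = (\<Sum>s\<in>?A. snd (p (?g s)))"
    proof -
      have "(\<Sum>s\<in>A. snd (p (?g s))) = (\<Sum>s\<in>A. snd (p (g s)))"
        using r by (intro sum.cong) auto
      then show ?thesis using r by (cases "p f") (simp add: collected_snoc coll)
    qed
    ultimately have "consistent (Suc n) ?h ?A ?g y"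
      using A by (simp add: consistent_def found_rays_simps del: history.simps)
    then show ?thesis by blast
  next
    case False
    then have far: "l < \<delta> f" if "f \<in> F - g ` A" for f using that by force
    \<comment> \<open>A ray may be entered again with a smaller depth, which reveals nothing
      new.\<close>
    let ?y = "y(r := max (y r) l)"
    have new_le: "spent A g y - y r + max (y r) l \<le> T"
    proof (rule ccontr)
      assume "\<not> ?thesis"
      then show False
        using le_T far ahead[OF r] by (intro not_truncated[of "T - spent A g y + y r"]) force+
    qed
    let ?h = "h @ [(r, l, None)]"
    have "admissible A g ?y"
      using A r y ahead far new_le legal(3) spent_upd(1)[OF A(1) r, of g y "max (y r) l"]
      unfolding admissible_def by (auto simp: max_def)
    moreover have "history \<sigma> (p \<circ> \<pi>) (Suc n) = ?h" if \<pi>: "compatible A g ?y \<pi>" for \<pi>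
    proof -
      have less: "ennreal (?y s) < fst (p (\<pi> s))" if "s \<in> {..<m} - A" for s
        using \<pi> that unfolding compatible_def by blast
      have "compatible A g y \<pi>"
        unfolding compatible_def
      proof (intro conjI ballI)
        fix s assume s: "s \<in> {..<m} - A"
        have "ennreal (y s) \<le> ennreal (?y s)" by (intro ennreal_leI) simp
        then show "ennreal (y s) < fst (p (\<pi> s))" using less[OF s] by (rule order.strict_trans1)
      qed (use \<pi> in \<open>auto simp: compatible_def\<close>)
      moreover have "ennreal l < fst (p (\<pi> r))"
        using less[OF r] by (rule order.strict_trans1[rotated]) (simp add: ennreal_leI)
      ultimately show ?thesis using hist by (simp add: rl not_le[symmetric])
    qed
    moreover have "ennreal (spent A g ?y) \<le> total ?h"
    proof -
      have "ennreal (spent A g ?y) \<le> ennreal (spent A g y + l)"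
        using spent_upd(1)[OF A(1) r, of g y "max (y r) l"] y[of r] legal(3)
        by (intro ennreal_leI) simp
      also have "\<dots> = ennreal (spent A g y) + ennreal l"
        using spent_nonneg legal(3) by (simp add: ennreal_plus)
      also have "\<dots> \<le> total h + ennreal l" using tot by (rule add_right_mono)
      finally show ?thesis by simp
    qed
    ultimately have "consistent (Suc n) ?h A g ?y"
      using A coll by (simp add: consistent_def found_rays_simps collected_snoc del: history.simps)
    then show ?thesis by blast
  qed
qed

text \<open>If all presentations were cheap, the game could be continued forever, and after each
  number of trips some compatible placement would be unfinished. There are finitely many
  permutations, so one of them would have infinite cost.\<close>

lemma costly_presentation: "\<exists>\<pi>. \<pi> permutes {..<m} \<and> ennreal T \<le> cost \<sigma> W (p \<circ> \<pi>)"
proof (rule ccontr)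
  assume "\<not> ?thesis"
  then have cheap: "cost \<sigma> W (p \<circ> \<pi>) < ennreal T" if "\<pi> permutes {..<m}" for \<pi>
    using that by (meson not_le)
  have consistent: "\<exists>h A g y. consistent n h A g y" for n
  proof (induction n)
    case 0
    have "consistent 0 [] {} id (\<lambda>_. 0)"
      using T_nonneg \<delta>_ge_1
      by (auto simp: consistent_def admissible_def spent_def found_rays_simps collected_def
          intro: less_le_trans[OF zero_less_one])
    then show ?case by blast
  qed (use consistent_step cheap in blast)
  let ?Q = "(\<lambda>\<pi>. p \<circ> \<pi>) ` {\<pi>. \<pi> permutes {..<m}}"
  have "\<exists>q\<in>?Q. cost \<sigma> W q = \<infinity>"
  proof (rule cost_infinite_if_never_all_collected)
    fix n
    obtain h A g y where cons: "consistent n h A g y" using consistent by blast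
    then obtain \<pi> where \<pi>: "compatible A g y \<pi>"
      using compatible_exists unfolding consistent_def by blast
    with cons have "history \<sigma> (p \<circ> \<pi>) n = h" by (simp add: consistent_def)
    with \<pi> consistent_collected(1)[OF cons] show "\<exists>q\<in>?Q. collected (history \<sigma> q n) < W"
      by (auto simp: compatible_def)
  qed (use weight_nonneg in \<open>auto intro: finite_permutations\<close>)
  then show False using cheap by force
qed

end

lemma intrinsic_cost_ge:
  assumes "\<And>\<sigma>. is_strategy m \<sigma> \<Longrightarrow> revealing_adversary m W T p F \<delta> \<sigma>"
  shows "ennreal T \<le> intrinsic_cost W (target_mset m p)"
  unfolding intrinsic_cost_def
proof (rule INF_greatest)
  fix \<sigma> assume "\<sigma> \<in> {\<sigma>. is_strategy (size (target_mset m p)) \<sigma>}"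
  then have "is_strategy m \<sigma>" by (simp add: target_mset_def)
  then interpret revealing_adversary m W T p F \<delta> \<sigma> by (rule assms)
  obtain \<pi> where \<pi>: "\<pi> permutes {..<m}" "ennreal T \<le> cost \<sigma> W (p \<circ> \<pi>)"
    using costly_presentation by blast
  from \<pi>(2) permute_in_presentations[OF \<pi>(1)]
  show "ennreal T \<le> (SUP q\<in>presentations (target_mset m p). cost \<sigma> W q)"
    by (rule SUP_upper2[rotated])
qed

subsection \<open>Dovetailing over dyadic depths\<close>

text \<open>
  All trips have a depth bound \<open>2 ^ i\<close>, which identifies their level \<open>i\<close> within the history.
\<close>

definition level_cost :: "trip list \<Rightarrow> nat \<Rightarrow> real" where
  "level_cost h i = (\<Sum>t\<leftarrow>h. if fst (snd t) = 2 ^ i then enn2real (reach t) else 0)"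

definition unexplored :: "nat \<Rightarrow> trip list \<Rightarrow> (nat \<times> nat) set" where
  "unexplored m h =
     {(r, i). r < m \<and> r \<notin> found_rays h \<and> (\<forall>l a. (r, l, a) \<in> set h \<longrightarrow> l < 2 ^ i)}"

text \<open>An upper bound for the cost of level \<open>i\<close> after one more trip on it.\<close>

definition priority :: "trip list \<Rightarrow> nat \<Rightarrow> real" where
  "priority h i = level_cost h i + 2 ^ i"

definition dovetail :: "nat \<Rightarrow> strategy" where
  "dovetail m h =
     (let (r, i) = SOME z. is_arg_min (\<lambda>z. priority h (snd z)) (\<lambda>z. z \<in> unexplored m h) z
      in (r, 2 ^ i))"

lemma level_cost_nonneg: "0 \<le> level_cost h i"
  unfolding level_cost_def by (rule sum_list_nonneg) auto

lemma level_cost_snoc: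
  "level_cost (h @ [t]) i = level_cost h i + (if fst (snd t) = 2 ^ i then enn2real (reach t) else 0)"
  by (simp add: level_cost_def)

text \<open>There are infinitely many levels, but priorities are at least \<open>2 ^ i\<close>, so
  only finitely many pairs can beat a given one.\<close>

lemma ex_minimal_unexplored:
  assumes "r < m" "r \<notin> found_rays h"
  shows "\<exists>z. is_arg_min (\<lambda>z. priority h (snd z)) (\<lambda>z. z \<in> unexplored m h) z"
proof -
  \<comment> \<open>Inserting 0 keeps \<open>Max\<close> meaningful for the empty history.\<close>
  obtain i where "Max (insert 0 ((\<lambda>t. fst (snd t)) ` set h)) < (2::real) ^ i"
    by (metis real_arch_pow one_less_numeral_iff semiring_norm(76))
  then have "\<forall>t\<in>set h. fst (snd t) < 2 ^ i" by simp
  then have open_i: "(r, i) \<in> unexplored m h" using assms by (force simp: unexplored_def)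
  define Z where "Z = {z \<in> unexplored m h. priority h (snd z) \<le> priority h i}"
  have "Z \<subseteq> {..<m} \<times> {..nat \<lceil>priority h i\<rceil>}"
  proof
    fix z assume z: "z \<in> Z"
    have "real (snd z) \<le> 2 ^ snd z" using of_nat_less_two_power[of "snd z"] by simp
    also have "\<dots> \<le> priority h (snd z)" using level_cost_nonneg by (simp add: priority_def)
    also have "\<dots> \<le> priority h i" using z by (simp add: Z_def)
    finally have "snd z \<le> nat \<lceil>priority h i\<rceil>" by linarith
    then show "z \<in> {..<m} \<times> {..nat \<lceil>priority h i\<rceil>}"
      using z by (cases z) (auto simp: Z_def unexplored_def)
  qed
  then have "finite Z" by (rule finite_subset) simp
  moreover have "Z \<noteq> {}" using open_i by (force simp: Z_def)
  ultimately obtain z where "is_arg_min (\<lambda>z. priority h (snd z)) (\<lambda>z. z \<in> Z) z"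
    using ex_is_arg_min_if_finite by blast
  then have "is_arg_min (\<lambda>z. priority h (snd z)) (\<lambda>z. z \<in> unexplored m h) z"
    unfolding is_arg_min_def Z_def by (smt (verit) mem_Collect_eq)
  then show ?thesis by blast
qed

lemma dovetail_cases:
  assumes "\<not> {..<m} \<subseteq> found_rays h"
  obtains r i where "dovetail m h = (r, 2 ^ i)" "(r, i) \<in> unexplored m h"
    "\<And>s j. (s, j) \<in> unexplored m h \<Longrightarrow> priority h i \<le> priority h j"
proof -
  let ?P = "is_arg_min (\<lambda>z. priority h (snd z)) (\<lambda>z. z \<in> unexplored m h)"
  obtain r i where ri: "(SOME z. ?P z) = (r, i)" by fastforce
  obtain s where "s < m" "s \<notin> found_rays h" using assms by blast
  then have "?P (SOME z. ?P z)" by (rule someI_ex[OF ex_minimal_unexplored])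
  then have "?P (r, i)" by (simp only: ri)
  moreover have "dovetail m h = (r, 2 ^ i)" by (simp add: dovetail_def ri)
  ultimately show ?thesis
    using that[of r i] unfolding is_arg_min_def not_less[symmetric] by fastforce
qed

lemma is_strategy_dovetail: "is_strategy m (dovetail m)"
  unfolding is_strategy_def
proof (intro allI impI)
  fix h assume "\<not> {..<m} \<subseteq> found_rays h"
  then show "case dovetail m h of (r, l) \<Rightarrow> r < m \<and> r \<notin> found_rays h \<and> 0 \<le> l"
    by (rule dovetail_cases) (auto simp: unexplored_def)
qed

lemma bound_make_trip: "fst (snd (make_trip p (r, l))) = l"
  by simp

lemma reach_make_trip: "reach (make_trip p (r, l)) = min (fst (p r)) (ennreal l)"
  by (cases "p r") (auto simp: min_def)

text \<open>Distinct levels have distinct depth bounds, so each trip is counted at exactly one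
  level.\<close>

lemma total_eq_sum_level_cost:
  assumes "\<And>t. t \<in> set h \<Longrightarrow> reach t < \<infinity> \<and> (\<exists>i<K. fst (snd t) = 2 ^ i)"
  shows "total h = ennreal (\<Sum>i<K. level_cost h i)"
  using assms
proof (induction h)
  case (Cons t h)
  from Cons.prems[of t] obtain k where k: "k < K" "fst (snd t) = 2 ^ k" "reach t < \<infinity>" by auto
  have "(\<Sum>i<K. level_cost (t # h) i) =
      (\<Sum>i<K. (if k = i then enn2real (reach t) else 0) + level_cost h i)"
    by (simp add: level_cost_def k)
  also have "\<dots> = enn2real (reach t) + (\<Sum>i<K. level_cost h i)"
    using k by (simp add: sum.distrib)
  finally show ?case
    using Cons k by (simp add: ennreal_plus sum_nonneg level_cost_nonneg)
qed (simp add: level_cost_def)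

text \<open>
  At most \<open>b\<close> levels satisfy \<open>2 ^ i \<le> V < 2 ^ (b + i)\<close>; on the lower ones the terms are
  geometric.
\<close>

lemma sum_min_powers_le:
  fixes V :: real
  assumes V: "0 \<le> V" and m: "real m \<le> 2 ^ b"
  shows "(\<Sum>i<K. if 2 ^ i \<le> V then min V (real m * 2 ^ i) else 0) \<le> (real b + 2) * V"
proof -
  define A where "A = {i\<in>{..<K}. 2 ^ i \<le> V \<and> V < 2 ^ (b + i)}"
  define B where "B = {i\<in>{..<K}. 2 ^ (b + i) \<le> V}"
  have fin: "finite A" "finite B" by (auto simp: A_def B_def)
  have "card A \<le> b"
  proof (cases "A = {}")
    case False
    have "A \<subseteq> {Min A..<Min A + b}"
    proof
      fix j assume j: "j \<in> A"
      have "Min A \<in> A" using fin False by simp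
      then have "V < 2 ^ (b + Min A)" by (simp add: A_def)
      moreover have "2 ^ j \<le> V" using j by (simp add: A_def)
      ultimately have "(2::real) ^ j < 2 ^ (b + Min A)" by (rule le_less_trans[rotated])
      then have "j < b + Min A" by (rule power_less_imp_less_exp[rotated]) simp
      then show "j \<in> {Min A..<Min A + b}" using fin j by simp
    qed
    then show ?thesis using card_mono[of "{Min A..<Min A + b}" A] by simp
  qed simp
  have "(\<Sum>i\<in>B. 2 ^ (b + i)) \<le> 2 * V"
  proof (cases "B = {}")
    case False
    have "(\<Sum>i\<in>B. (2::real) ^ (b + i)) \<le> (\<Sum>i<Suc (Max B). 2 ^ (b + i))"
      using fin by (intro sum_mono2) (auto simp: less_Suc_eq_le)
    also have "\<dots> = 2 ^ b * (2 ^ Suc (Max B) - 1)"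
      using geometric_sum[of "2::real" "Suc (Max B)"]
      by (simp add: power_add flip: sum_distrib_left)
    also have "\<dots> \<le> 2 * 2 ^ (b + Max B)" by (simp add: power_add algebra_simps)
    also have "\<dots> \<le> 2 * V" using Max_in[OF fin(2) False] by (simp add: B_def)
    finally show ?thesis .
  qed (use V in simp)
  have "(\<Sum>i<K. if 2 ^ i \<le> V then min V (real m * 2 ^ i) else 0) \<le>
      (\<Sum>i<K. (if i \<in> A then V else 0) + (if i \<in> B then 2 ^ (b + i) else 0))"
  proof (rule sum_mono)
    fix i assume "i \<in> {..<K}"
    moreover have "real m * 2 ^ i \<le> 2 ^ (b + i)" using m by (simp add: power_add)
    ultimately show "(if 2 ^ i \<le> V then min V (real m * 2 ^ i) else 0) \<le>
        (if i \<in> A then V else 0) + (if i \<in> B then 2 ^ (b + i) else 0)"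
      using V by (auto simp: A_def B_def min_def)
  qed
  also have "\<dots> = (\<Sum>i\<in>A. V) + (\<Sum>i\<in>B. 2 ^ (b + i))"
  proof -
    have "A \<inter> {..<K} = A" "B \<inter> {..<K} = B" by (auto simp: A_def B_def)
    then show ?thesis
      using sum.inter_restrict[of "{..<K}" "\<lambda>_. V" A]
        sum.inter_restrict[of "{..<K}" "\<lambda>i. 2 ^ (b + i) :: real" B]
      by (simp add: sum.distrib Int_commute)
  qed
  also have "\<dots> \<le> real b * V + 2 * V"
    using \<open>card A \<le> b\<close> \<open>(\<Sum>i\<in>B. 2 ^ (b + i)) \<le> 2 * V\<close> V
    by (intro add_mono) (auto intro: mult_right_mono)
  finally show ?thesis by (simp add: algebra_simps)
qed

section \<open>The run of the dovetailing strategy\<close>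

abbreviation run :: "nat \<Rightarrow> placement \<Rightarrow> nat \<Rightarrow> trip list" where
  "run m \<equiv> history (dovetail m)"

definition visited :: "trip list \<Rightarrow> nat \<Rightarrow> nat set" where
  "visited h i = {r. \<exists>a. (r, 2 ^ i, a) \<in> set h}"

text \<open>The second conjunct says that only levels with \<open>2 ^ i \<le> V\<close> have been
  used.\<close>

definition bounded_levels :: "trip list \<Rightarrow> real \<Rightarrow> bool" where
  "bounded_levels h V \<longleftrightarrow> (\<forall>i. level_cost h i \<le> V) \<and> (\<forall>t\<in>set h. fst (snd t) \<le> V)"

lemma run_trips:
  assumes "\<forall>k<n. \<not> {..<m} \<subseteq> found_rays (run m p k)" "t \<in> set (run m p n)"
  shows "\<exists>r i. r < m \<and> t = make_trip p (r, 2 ^ i)"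
  using assms
proof (induction n)
  case (Suc n)
  obtain r i where ri: "dovetail m (run m p n) = (r, 2 ^ i)" "(r, i) \<in> unexplored m (run m p n)"
    by (rule dovetail_cases[of m "run m p n"]) (use Suc.prems(1) in blast)+
  show ?case
  proof (cases "t \<in> set (run m p n)")
    case True
    then show ?thesis using Suc.IH Suc.prems(1) by simp
  next
    case False
    then have "t = make_trip p (r, 2 ^ i)" using Suc.prems(2) by (simp add: ri del: make_trip.simps)
    then show ?thesis using ri(2) unfolding unexplored_def by blast
  qed
qed simp

lemma run_found:
  assumes "\<forall>k<n. \<not> {..<m} \<subseteq> found_rays (run m p k)" "f \<in> found_rays (run m p n)"
  shows "f < m \<and> fst (p f) < \<infinity>"
proof -
  obtain l a where "(f, l, Some a) \<in> set (run m p n)" using assms(2) by (auto simp: found_rays_def)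
  from run_trips[OF assms(1) this] show ?thesis
    by (auto split: if_splits intro: le_less_trans)
qed

text \<open>No ray is visited twice on the same level, so the trips of a level correspond to the set
  of rays visited there.\<close>

lemma run_level_cost:
  assumes "\<forall>k<n. \<not> {..<m} \<subseteq> found_rays (run m p k)"
  shows "level_cost (run m p n) i = (\<Sum>r\<in>visited (run m p n) i. enn2real (min (fst (p r)) (ennreal (2 ^ i))))"
  using assms
proof (induction n)
  case (Suc n)
  obtain r j where rj: "dovetail m (run m p n) = (r, 2 ^ j)" "(r, j) \<in> unexplored m (run m p n)"
    by (rule dovetail_cases[of m "run m p n"]) (use Suc.prems(1) in blast)+
  have fin: "finite (visited (run m p n) i)"
    by (rule finite_subset[of _ "fst ` set (run m p n)"]) (force simp: visited_def)+
  have run: "run m p (Suc n) = run m p n @ [make_trip p (r, 2 ^ j)]" by (simp add: rj)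
  have visited: "visited (run m p (Suc n)) i =
      (if i = j then insert r (visited (run m p n) i) else visited (run m p n) i)"
    unfolding run by (auto simp: visited_def)
  have "r \<notin> visited (run m p n) j" using rj(2) by (auto simp: visited_def unexplored_def)
  moreover have "level_cost (run m p (Suc n)) i = level_cost (run m p n) i +
      (if i = j then enn2real (min (fst (p r)) (ennreal (2 ^ i))) else 0)"
    unfolding run level_cost_snoc bound_make_trip reach_make_trip by auto
  moreover have "level_cost (run m p n) i =
      (\<Sum>r\<in>visited (run m p n) i. enn2real (min (fst (p r)) (ennreal (2 ^ i))))"
    using Suc by simp
  ultimately show ?case unfolding visited using fin by (cases "i = j") simp_all
qed (simp add: level_cost_def visited_def)

lemma visited_subset:
  assumes "\<forall>k<n. \<not> {..<m} \<subseteq> found_rays (run m p k)"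
  shows "visited (run m p n) i \<subseteq> {..<m}"
  using run_trips[OF assms] by (fastforce simp: visited_def)

lemma run_level_cost_le:
  assumes "\<forall>k<n. \<not> {..<m} \<subseteq> found_rays (run m p k)"
  shows "level_cost (run m p n) i \<le> real m * 2 ^ i"
proof -
  have "level_cost (run m p n) i \<le> (\<Sum>r\<in>visited (run m p n) i. 2 ^ i)"
    unfolding run_level_cost[OF assms]
    by (intro sum_mono enn2real_leI) auto
  also have "\<dots> \<le> (\<Sum>r\<in>{..<m}. 2 ^ i)"
    using visited_subset[OF assms] by (intro sum_mono2) auto
  finally show ?thesis by simp
qed

lemma bounded_levels_step:
  assumes "(r, i) \<in> unexplored m h" "bounded_levels h (priority h i)"
  shows "bounded_levels (h @ [make_trip p (r, 2 ^ i)]) (priority h i)"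
proof -
  have "enn2real (min (fst (p r)) (ennreal (2 ^ i))) \<le> 2 ^ i"
    by (intro enn2real_leI) auto
  then have "level_cost (h @ [make_trip p (r, 2 ^ i)]) j \<le> priority h i" for j
    using assms(2)
    by (auto simp: level_cost_snoc bounded_levels_def reach_make_trip priority_def
        simp del: make_trip.simps) (auto simp: priority_def)
  moreover have "2 ^ i \<le> priority h i" using level_cost_nonneg by (simp add: priority_def)
  ultimately show ?thesis using assms(2) by (auto simp: bounded_levels_def)
qed

text \<open>Pairs only leave \<open>unexplored\<close> and priorities only grow, so the minimal
  priority never decreases. Each trip therefore stays within the bound given by any priority still
  open later.\<close>

lemma bounded_levels_run:
  assumes "\<forall>k<n. \<not> {..<m} \<subseteq> found_rays (run m p k)" "(s, j) \<in> unexplored m (run m p n)"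
  shows "bounded_levels (run m p n) (priority (run m p n) j)"
  using assms
proof (induction n arbitrary: s j)
  case 0
  then show ?case by (simp add: bounded_levels_def level_cost_def priority_def)
next
  case (Suc n)
  obtain r i where ri: "dovetail m (run m p n) = (r, 2 ^ i)" "(r, i) \<in> unexplored m (run m p n)"
    and min: "\<And>s j. (s, j) \<in> unexplored m (run m p n) \<Longrightarrow> priority (run m p n) i \<le> priority (run m p n) j"
    by (rule dovetail_cases[of m "run m p n"]) (use Suc.prems(1) in blast)+
  have run: "run m p (Suc n) = run m p n @ [make_trip p (r, 2 ^ i)]" by (simp add: ri)
  have "bounded_levels (run m p (Suc n)) (priority (run m p n) i)"
    unfolding run using ri(2) by (rule bounded_levels_step) (use Suc ri in auto)
  moreover have "(s, j) \<in> unexplored m (run m p n)"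
    using Suc.prems(2) unfolding run unexplored_def found_rays_def by auto
  then have "priority (run m p n) i \<le> priority (run m p n) j" by (rule min)
  moreover have "priority (run m p n) j \<le> priority (run m p (Suc n)) j"
    unfolding run priority_def level_cost_snoc by simp
  ultimately show ?case by (force simp: bounded_levels_def intro: order.trans)
qed

lemma total_run_le:
  assumes "\<forall>k<n. \<not> {..<m} \<subseteq> found_rays (run m p k)" "bounded_levels (run m p n) V" "0 \<le> V"
    "real m \<le> 2 ^ b"
  shows "total (run m p n) \<le> ennreal ((real b + 2) * V)"
proof -
  define K where "K = Suc (nat \<lceil>V\<rceil>)"
  have level_le: "i < K" if "2 ^ i \<le> V" for i
  proof -
    have "real i < 2 ^ i" by (rule of_nat_less_two_power)
    then have "real i < V" using that by (rule less_le_trans)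
    then show ?thesis by (simp add: K_def) linarith
  qed
  have "total (run m p n) = ennreal (\<Sum>i<K. level_cost (run m p n) i)"
  proof (rule total_eq_sum_level_cost)
    fix t assume t: "t \<in> set (run m p n)"
    then obtain r i where ri: "t = make_trip p (r, 2 ^ i)" using run_trips[OF assms(1)] by blast
    have "2 ^ i \<le> V" using assms(2) t by (force simp: bounded_levels_def ri)
    then have "i < K" by (rule level_le)
    moreover have "reach t < \<infinity>" unfolding ri reach_make_trip by (simp add: min_less_iff_disj)
    ultimately show "reach t < \<infinity> \<and> (\<exists>i<K. fst (snd t) = 2 ^ i)" by (auto simp: ri)
  qed
  also have "\<dots> \<le> ennreal (\<Sum>i<K. if 2 ^ i \<le> V then min V (real m * 2 ^ i) else 0)"
  proof (intro ennreal_leI sum_mono)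
    fix i
    show "level_cost (run m p n) i \<le> (if 2 ^ i \<le> V then min V (real m * 2 ^ i) else 0)"
    proof (cases "2 ^ i \<le> V")
      case False
      then have "visited (run m p n) i = {}"
        using assms(2) by (force simp: visited_def bounded_levels_def)
      then show ?thesis using False by (simp add: run_level_cost[OF assms(1)])
    qed (use assms(2) run_level_cost_le[OF assms(1)] in \<open>simp add: bounded_levels_def\<close>)
  qed
  also have "\<dots> \<le> ennreal ((real b + 2) * V)"
    by (intro ennreal_leI sum_min_powers_le assms)
  finally show ?thesis .
qed

text \<open>Every trip has reach at least 1, so a bound on the distance bounds the number of trips
  and rules out endless searching.\<close>

lemma length_le_total_run:
  assumes dist_ge_1: "\<And>i. i < m \<Longrightarrow> 1 \<le> fst (p i)"
    and "\<forall>k<n. \<not> {..<m} \<subseteq> found_rays (run m p k)"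
  shows "of_nat n \<le> total (run m p n)"
  using assms(2)
proof (induction n)
  case (Suc n)
  obtain r i where ri: "dovetail m (run m p n) = (r, 2 ^ i)" "(r, i) \<in> unexplored m (run m p n)"
    by (rule dovetail_cases[of m "run m p n"]) (use Suc.prems in blast)+
  have "(1::ennreal) \<le> ennreal (2 ^ i)" by (simp flip: ennreal_1 add: ennreal_leI)
  then have "1 \<le> reach (make_trip p (r, 2 ^ i))"
    using dist_ge_1 ri(2) by (auto simp: reach_make_trip unexplored_def simp del: make_trip.simps)
  then have "of_nat n + 1 \<le> total (run m p n) + reach (make_trip p (r, 2 ^ i))"
    using Suc by (intro add_mono) auto
  then show ?case by (simp add: ri add.commute del: make_trip.simps)
qed simp

section \<open>Comparison of the dovetailing run with the intrinsic cost\<close>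

context
  fixes m :: nat and p :: placement and W :: real
  assumes dist_ge_1: "\<And>i. i < m \<Longrightarrow> 1 \<le> fst (p i)"
    and weight_nonneg: "\<And>i. i < m \<Longrightarrow> 0 \<le> snd (p i)"
    and W_le: "W \<le> (\<Sum>i<m. snd (p i))"
begin

text \<open>The adversary gives away exactly the targets found online. For its
  \<open>threshold\<close> at \<open>x\<close>, take a level with
  \<open>x \<le> 2 ^ i \<le> 2 * x\<close>: an unfound target within \<open>x\<close> keeps the
  level open, so \<open>V\<close> is at most its priority. This is split into found rays, unfound
  visited rays and the summand \<open>2 ^ i\<close>; rounding \<open>x\<close> loses the factor
  2.\<close>

lemma intrinsic_cost_ge_priority:
  assumes uncollected: "\<forall>k\<le>n. collected (run m p k) < W"
    and V: "\<And>s j. (s, j) \<in> unexplored m (run m p n) \<Longrightarrow> V \<le> priority (run m p n) j"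
    and T: "0 \<le> T" "2 * T < V"
  shows "ennreal T \<le> intrinsic_cost W (target_mset m p)"
proof -
  have unfound: "\<forall>k<n. \<not> {..<m} \<subseteq> found_rays (run m p k)"
    using not_all_found[OF is_strategy_dovetail W_le] uncollected by (meson le_trans less_imp_le)
  define F where "F = found_rays (run m p n)"
  define \<delta> where "\<delta> f = enn2real (fst (p f))" for f
  have F_iff: "f < m \<and> fst (p f) < \<infinity>" if "f \<in> F" for f
    using run_found[OF unfound] that by (simp add: F_def)
  have F_sub: "F \<subseteq> {..<m}" using F_iff by blast
  have fin: "finite F" by (simp add: F_def finite_found_rays)
  have F_dist: "fst (p f) = ennreal (\<delta> f)" "1 \<le> \<delta> f" if "f \<in> F" for f
  proof -
    show *: "fst (p f) = ennreal (\<delta> f)" using F_iff[OF that] by (simp add: \<delta>_def)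
    have "ennreal 1 \<le> ennreal (\<delta> f)"
      using dist_ge_1[of f] F_iff[OF that] unfolding * by simp
    then show "1 \<le> \<delta> f" by (simp add: \<delta>_def ennreal_le_iff2)
  qed
  \<comment> \<open>A ray searched as far as its target would have been found.\<close>
  have not_far: "l < x" if "(u, l, a) \<in> set (run m p n)" "u < m" "u \<notin> F" "fst (p u) \<le> ennreal x" for u l a x
  proof (rule ccontr)
    assume "\<not> l < x"
    then have le: "fst (p u) \<le> ennreal l" using that(4) by (meson ennreal_leI not_less order.trans)
    from run_trips[OF unfound that(1)] le have "a = Some (p u)" by auto
    then show False using that(1,3) by (cases "p u") (auto simp: F_def found_rays_def)
  qed
  have threshold: "T < (\<Sum>f\<in>F. min (\<delta> f) x) + x * (card {u\<in>{..<m} - F. ennreal x < fst (p u)} + 1)"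
    if x: "1 \<le> x" and u: "\<exists>u\<in>{..<m} - F. fst (p u) \<le> ennreal x" for x
  proof -
    obtain i where i: "x \<le> 2 ^ i" "2 ^ i \<le> 2 * x"
    proof -
      define i where "i = (LEAST i. x \<le> 2 ^ i)"
      have "\<exists>i. x \<le> 2 ^ i" using real_arch_pow[of 2 x] by (auto intro: less_imp_le)
      then have "x \<le> 2 ^ i" unfolding i_def by (rule LeastI_ex)
      moreover have "2 ^ i \<le> 2 * x"
      proof (cases i)
        case (Suc k)
        then have "\<not> x \<le> 2 ^ k" using not_less_Least[of k "\<lambda>i. x \<le> 2 ^ i"] by (simp add: i_def)
        then show ?thesis by (simp add: Suc)
      qed (use x in simp)
      ultimately show ?thesis using that by blast
    qed
    let ?far = "{u\<in>{..<m} - F. ennreal x < fst (p u)}"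
    let ?N = "visited (run m p n) i" and ?d = "\<lambda>r. enn2real (min (fst (p r)) (ennreal (2 ^ i)))"
    have [simp]: "finite ?N"
      using visited_subset[OF unfound] finite_subset by blast
    obtain u where u: "u < m" "u \<notin> F" "fst (p u) \<le> ennreal x" using u by blast
    have "l < 2 ^ i" if "(u, l, a) \<in> set (run m p n)" for l a
      using not_far[OF that u] i by simp
    then have "(u, i) \<in> unexplored m (run m p n)" using u by (auto simp: unexplored_def F_def)
    then have "V \<le> level_cost (run m p n) i + 2 ^ i" using V by (auto simp: priority_def)
    moreover have "level_cost (run m p n) i = sum ?d ?N"
      by (rule run_level_cost[OF unfound])
    moreover have "sum ?d ?N = sum ?d (?N \<inter> F) + sum ?d (?N - F)" by (rule sum.Int_Diff) simp
    moreover have "sum ?d (?N \<inter> F) \<le> 2 * (\<Sum>f\<in>F. min (\<delta> f) x)"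
    proof -
      have "sum ?d (?N \<inter> F) \<le> (\<Sum>f\<in>?N \<inter> F. 2 * min (\<delta> f) x)"
      proof (rule sum_mono)
        fix f assume f: "f \<in> ?N \<inter> F"
        have "?d f \<le> min (\<delta> f) (2 ^ i)"
          using f F_dist[of f] by (intro enn2real_leI) (auto simp: min_def ennreal_leI)
        also have "\<dots> \<le> 2 * min (\<delta> f) x" using i F_dist(2)[of f] f by auto
        finally show "?d f \<le> 2 * min (\<delta> f) x" .
      qed
      also have "\<dots> \<le> (\<Sum>f\<in>F. 2 * min (\<delta> f) x)"
        using fin F_dist(2) x by (intro sum_mono2) force+
      finally show ?thesis by (simp add: sum_distrib_left)
    qed
    moreover have "sum ?d (?N - F) \<le> 2 * x * card ?far"
    proof -
      \<comment> \<open>These rays were searched to depth at least \<open>x\<close> in vain, so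
        their targets lie beyond \<open>x\<close>.\<close>
      have "?N - F \<subseteq> ?far"
      proof
        fix r assume r: "r \<in> ?N - F"
        then obtain a where a: "(r, 2 ^ i, a) \<in> set (run m p n)" by (auto simp: visited_def)
        have "r < m" using r visited_subset[OF unfound] by auto
        moreover have "\<not> fst (p r) \<le> ennreal x"
          using not_far[OF a \<open>r < m\<close>, of x] r i by auto
        ultimately show "r \<in> ?far" using r by auto
      qed
      then have "card (?N - F) \<le> card ?far" by (intro card_mono) auto
      have "sum ?d (?N - F) \<le> (\<Sum>r\<in>?N - F. 2 * x)"
        using i x by (intro sum_mono enn2real_leI) (auto intro!: min.coboundedI2 ennreal_leI)
      also have "\<dots> \<le> card ?far * (2 * x)"
        using \<open>card (?N - F) \<le> card ?far\<close> x by (auto intro: mult_right_mono)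
      finally show ?thesis by (simp add: mult_ac)
    qed
    ultimately have "V \<le> 2 * ((\<Sum>f\<in>F. min (\<delta> f) x) + x * (card ?far + 1))"
      using i by (simp add: algebra_simps)
    then show ?thesis using T by simp
  qed
  \<comment> \<open>The weights of \<open>p\<close> at arguments \<open>i \<ge> m\<close> may be negative.\<close>
  define q where "q i = (if i < m then p i else (1, 0))" for i
  have q: "q i = p i" if "i < m" for i using that by (simp add: q_def)
  have "ennreal T \<le> intrinsic_cost W (target_mset m q)"
  proof (rule intrinsic_cost_ge)
    fix \<sigma> assume \<sigma>: "is_strategy m \<sigma>"
    have Fq: "(\<Sum>f\<in>F. snd (q f)) < W"
    proof -
      have "(\<Sum>f\<in>F. snd (q f)) = (\<Sum>f\<in>F. snd (p f))"
        using F_sub by (intro sum.cong) (auto simp: q_def)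
      then show ?thesis
        using collected_eq_sum_found[OF is_strategy_dovetail unfound] uncollected
        by (auto simp: F_def)
    qed
    have Wq: "W \<le> (\<Sum>i<m. snd (q i))" using W_le by (simp add: q_def)
    have far_q: "{u\<in>{..<m} - F. ennreal x < fst (q u)} = {u\<in>{..<m} - F. ennreal x < fst (p u)}" for x
      by (auto simp: q_def)
    show "revealing_adversary m W T q F \<delta> \<sigma>"
    proof
      fix x assume "1 \<le> x" "\<exists>u\<in>{..<m} - F. fst (q u) \<le> ennreal x"
      then show "T < (\<Sum>f\<in>F. min (\<delta> f) x) + x * (card {u\<in>{..<m} - F. ennreal x < fst (q u)} + 1)"
        unfolding far_q by (intro threshold) (auto simp: q_def)
    next
      fix f assume "f \<in> F"
      then show "fst (q f) = ennreal (\<delta> f)" using F_dist F_sub q by (simp add: subset_iff)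
    qed (use F_sub F_dist weight_nonneg dist_ge_1 T \<sigma> Fq Wq in \<open>auto simp: q_def\<close>)
  qed
  also have "target_mset m q = target_mset m p"
    unfolding target_mset_def by (intro image_mset_cong) (simp add: q_def)
  finally show ?thesis .
qed

lemma total_run_le_intrinsic_cost:
  assumes uncollected: "\<forall>k\<le>n. collected (run m p k) < W" and b: "real m \<le> 2 ^ b"
  shows "total (run m p (Suc n)) \<le> ennreal (4 * (real b + 2)) * intrinsic_cost W (target_mset m p)"
proof -
  have unfound: "\<forall>k<Suc n. \<not> {..<m} \<subseteq> found_rays (run m p k)"
    using not_all_found[OF is_strategy_dovetail W_le] uncollected
    by (meson le_trans less_Suc_eq_le)
  obtain r i where ri: "dovetail m (run m p n) = (r, 2 ^ i)" "(r, i) \<in> unexplored m (run m p n)"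
    and min: "\<And>s j. (s, j) \<in> unexplored m (run m p n) \<Longrightarrow> priority (run m p n) i \<le> priority (run m p n) j"
    by (rule dovetail_cases[of m "run m p n"]) (use unfound in blast)+
  define V where "V = priority (run m p n) i"
  have V: "0 < V"
    using level_cost_nonneg[of "run m p n" i] by (auto simp: V_def priority_def intro: add_nonneg_pos)
  have "bounded_levels (run m p n) V"
    unfolding V_def by (rule bounded_levels_run[OF _ ri(2)]) (use unfound in auto)
  then have "bounded_levels (run m p n @ [make_trip p (r, 2 ^ i)]) V"
    unfolding V_def by (intro bounded_levels_step[OF ri(2)])
  then have "bounded_levels (run m p (Suc n)) V" by (simp add: ri(1) del: make_trip.simps)
  then have "total (run m p (Suc n)) \<le> ennreal ((real b + 2) * V)"
    using V by (intro total_run_le[OF unfound _ _ b]) auto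
  also have "\<dots> = ennreal (4 * (real b + 2)) * ennreal (V / 4)"
    using V by (subst ennreal_mult[symmetric]) (auto simp: algebra_simps)
  \<comment> \<open>The choice \<open>V / 4\<close> makes \<open>2 * T < V\<close> strict.\<close>
  also have "ennreal (V / 4) \<le> intrinsic_cost W (target_mset m p)"
    using V min by (intro intrinsic_cost_ge_priority[OF uncollected, of V]) (auto simp: V_def)
  finally show ?thesis by (simp add: mult_left_mono)
qed

text \<open>A finite intrinsic cost bounds the distance of every unfinished run, hence its number of
  trips, so the search ends. Return journeys double the factor 4 to 8.\<close>

lemma cost_dovetail_le:
  assumes b: "real m \<le> 2 ^ b"
  shows "cost (dovetail m) W p \<le> ennreal (8 * (real b + 2)) * intrinsic_cost W (target_mset m p)"
proof (cases "intrinsic_cost W (target_mset m p) = \<infinity>")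
  case True
  then show ?thesis by (simp add: ennreal_mult_top)
next
  case False
  then obtain x where x: "0 \<le> x" "intrinsic_cost W (target_mset m p) = ennreal x"
    by (cases "intrinsic_cost W (target_mset m p)") auto
  have ex: "\<exists>n. W \<le> collected (run m p n)"
  proof (rule ccontr)
    assume "\<not> ?thesis"
    then have less: "collected (run m p k) < W" for k by (simp add: not_le)
    define n where "n = nat \<lceil>4 * (real b + 2) * x\<rceil>"
    have "of_nat (Suc n) \<le> total (run m p (Suc n))"
      using not_all_found[OF is_strategy_dovetail W_le] less
      by (intro length_le_total_run dist_ge_1) auto
    also have "\<dots> \<le> ennreal (4 * (real b + 2)) * ennreal x"
      using total_run_le_intrinsic_cost[OF _ b, of n] less by (simp add: x)
    also have "\<dots> = ennreal (4 * (real b + 2) * x)"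
      using x by (simp add: ennreal_mult)
    finally have "real (Suc n) \<le> 4 * (real b + 2) * x"
      using x by (simp add: ennreal_of_nat_eq_real_of_nat ennreal_le_iff del: of_nat_Suc)
    then show False unfolding n_def by linarith
  qed
  define n where "n = (LEAST n. W \<le> collected (run m p n))"
  have cost: "cost (dovetail m) W p = travelled (run m p n)" using ex by (simp add: cost_def n_def)
  show ?thesis
  proof (cases n)
    case 0
    then show ?thesis by (simp add: cost travelled_def)
  next
    case (Suc k)
    have "collected (run m p j) < W" if "j \<le> k" for j
      using not_less_Least[of j "\<lambda>n. W \<le> collected (run m p n)"] that Suc by (simp add: n_def)
    then have "total (run m p n) \<le> ennreal (4 * (real b + 2)) * intrinsic_cost W (target_mset m p)"
      unfolding Suc by (intro total_run_le_intrinsic_cost b) auto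
    then have "2 * total (run m p n) \<le> 2 * (ennreal (4 * (real b + 2)) * ennreal x)"
      unfolding x by (rule mult_left_mono) simp
    also have "\<dots> = ennreal 2 * ennreal (4 * (real b + 2)) * ennreal x"
      by (simp only: mult.assoc ennreal_numeral)
    also have "\<dots> = ennreal (8 * (real b + 2)) * ennreal x"
      by (subst ennreal_mult[symmetric]) auto
    finally show ?thesis
      unfolding cost x using travelled_le_total order.trans by blast
  qed
qed

end

lemma competitive_ratio_dovetail:
  assumes "m \<ge> 2"
  shows "competitive_ratio m (dovetail m) \<le> ennreal (32 / ln 2 * ln m)"
  unfolding competitive_ratio_def
proof (rule SUP_least, clarify)
  fix W p assume inst: "(W, p) \<in> instances m"
  define b where "b = nat \<lceil>log 2 m\<rceil>"
  have log_ge: "1 \<le> log 2 m" using assms by (simp add: le_log_iff)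
  have b: "log 2 m \<le> b" "real b \<le> log 2 m + 1" using log_ge unfolding b_def by linarith+
  have "m = 2 powr log 2 m" using assms by simp
  also have "\<dots> \<le> 2 powr b" using b by (intro powr_mono) auto
  finally have "real m \<le> 2 ^ b" by (simp add: powr_realpow)
  then have "cost (dovetail m) W p \<le> ennreal (8 * (real b + 2)) * intrinsic_cost W (target_mset m p)"
    using inst by (intro cost_dovetail_le) (auto simp: instances_def)
  \<comment> \<open>If the intrinsic cost is 0, then so is the online cost, and the quotient is
    \<open>0 / 0 = 0\<close>.\<close>
  then have "cost (dovetail m) W p / intrinsic_cost W (target_mset m p) \<le> ennreal (8 * (real b + 2))"
    by (cases "intrinsic_cost W (target_mset m p) = 0")
      (auto intro!: divide_le_posI_ennreal simp: mult.commute zero_less_iff_neq_zero)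
  also have "\<dots> \<le> ennreal (32 / ln 2 * ln m)"
  proof (rule ennreal_leI)
    \<comment> \<open>As \<open>1 \<le> log 2 m\<close>, the sum \<open>b + 2\<close> is at most
      \<open>4 * log 2 m\<close>.\<close>
    have "8 * (real b + 2) \<le> 32 * log 2 m" using b log_ge by simp
    then show "8 * (real b + 2) \<le> 32 / ln 2 * ln m" by (simp add: log_def)
  qed
  finally show "cost (dovetail m) W p / intrinsic_cost W (target_mset m p) \<le> ennreal (32 / ln 2 * ln m)" .
qed

subsection \<open>The harmonic lower bound\<close>

lemma ennreal_inverse_mono: "a \<le> b \<Longrightarrow> inverse b \<le> inverse (a::ennreal)"
  by (cases "a = 0"; cases a b rule: ennreal2_cases)
    (auto simp: inverse_ennreal top_unique ennreal_leI less_le)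

section \<open>Hard placements and their intrinsic cost\<close>

definition blank :: placement where
  "blank = (\<lambda>_. (\<infinity>, 1))"

text \<open>The empty rays, those in \<open>Z\<close>, are modelled by targets at infinite distance.
  They keep weight 1, so the total weight does not depend on \<open>Z\<close>.\<close>

definition two_level :: "nat \<Rightarrow> nat \<Rightarrow> nat set \<Rightarrow> placement" where
  "two_level m k Z r = (if r < m \<and> r \<notin> Z then (ennreal (m / k), 1) else (\<infinity>, 1))"

definition hard_placements :: "nat \<Rightarrow> placement set" where
  "hard_placements m = {two_level m k Z | k Z. k \<in> {1..m} \<and> Z \<subseteq> {..<m} \<and> card Z < k}"

text \<open>Until something is found, \<open>length h\<close> is the next fresh ray. The
  \<open>LEAST\<close> branch only keeps the strategy legal afterwards.\<close>

definition sweep :: "nat \<Rightarrow> real \<Rightarrow> strategy" where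
  "sweep m x h =
     (if length h < m \<and> length h \<notin> found_rays h then length h
      else LEAST r. r < m \<and> r \<notin> found_rays h, x)"

lemma is_strategy_sweep:
  assumes "0 \<le> x"
  shows "is_strategy m (sweep m x)"
  unfolding is_strategy_def
proof (intro allI impI)
  fix h assume "\<not> {..<m} \<subseteq> found_rays h"
  then have "\<exists>r. r < m \<and> r \<notin> found_rays h" by blast
  from LeastI_ex[OF this] assms
  show "case sweep m x h of (r, l) \<Rightarrow> r < m \<and> r \<notin> found_rays h \<and> 0 \<le> l"
    by (simp add: sweep_def)
qed

lemma total_sweep_le: "total (history (sweep m x) p n) \<le> of_nat n * ennreal x"
proof (induction n)
  case (Suc n)
  obtain r where r: "sweep m x (history (sweep m x) p n) = (r, x)" by (simp add: sweep_def)
  have "reach (make_trip p (r, x)) \<le> ennreal x" by (simp add: reach_make_trip del: make_trip.simps)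
  then have "total (history (sweep m x) p n) + reach (make_trip p (r, x))
      \<le> of_nat n * ennreal x + ennreal x"
    using Suc by (rule add_mono[rotated])
  then show ?case by (simp add: r distrib_right add.commute del: make_trip.simps)
qed simp

lemma history_sweep:
  assumes "n \<le> m" "\<And>j. j \<le> n \<Longrightarrow> collected (history (sweep m x) p j) < 1"
    "\<And>r. r < m \<Longrightarrow> snd (p r) = 1"
  shows "history (sweep m x) p n = map (\<lambda>r. (r, x, None)) [0..<n] \<and> (\<forall>r<n. ennreal x < fst (p r))"
  using assms(1,2)
proof (induction n)
  case (Suc n)
  let ?h = "history (sweep m x) p n"
  have h: "?h = map (\<lambda>r. (r, x, None)) [0..<n]" and far: "\<forall>r<n. ennreal x < fst (p r)"
    using Suc by auto
  have "found_rays ?h = {}" unfolding h by (auto simp: found_rays_def)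
  then have next_ray: "sweep m x ?h = (n, x)" using Suc.prems(1) by (simp add: sweep_def h)
  have "collected ?h = 0" unfolding h by (simp add: collected_def comp_def)
  moreover have "collected (?h @ [make_trip p (n, x)]) < 1"
    using Suc.prems(2)[of "Suc n"] by (simp add: next_ray del: make_trip.simps)
  ultimately have "\<not> fst (p n) \<le> ennreal x"
    using assms(3)[of n] Suc.prems(1) by (cases "p n") (auto simp: collected_snoc)
  then have "make_trip p (n, x) = (n, x, None)" "ennreal x < fst (p n)" by auto
  then have "history (sweep m x) p (Suc n) = ?h @ [(n, x, None)]" "\<forall>r<Suc n. ennreal x < fst (p r)"
    using far unfolding history.simps next_ray by (auto simp: less_Suc_eq)
  then show ?case by (simp add: h)
qed simp

text \<open>Carries the number of empty rays over to every presentation of the same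
  multiset.\<close>

lemma card_eq_target:
  "card {r\<in>{..<m}. p r = t} = count (target_mset m p) t"
  by (simp add: target_mset_def count_image_mset_eq_card_vimage)

text \<open>Fewer than \<open>k\<close> rays are empty, so in each presentation one of the first
  \<open>k\<close> rays holds a target within \<open>m / k\<close>; at most \<open>k\<close> round
  trips of that depth suffice.\<close>

lemma intrinsic_cost_two_level:
  assumes k: "k \<in> {1..m}" and Z: "Z \<subseteq> {..<m}" "card Z < k"
  shows "intrinsic_cost 1 (target_mset m (two_level m k Z)) \<le> ennreal (2 * m)"
  unfolding intrinsic_cost_def
proof (rule INF_lower2)
  let ?x = "real m / real k" and ?q = "two_level m k Z"
  have size: "size (target_mset m ?q) = m" by (simp add: target_mset_def)
  show "sweep m ?x \<in> {\<sigma>. is_strategy (size (target_mset m ?q)) \<sigma>}"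
    unfolding size by (simp add: is_strategy_sweep)
  show "(SUP p\<in>presentations (target_mset m ?q). cost (sweep m ?x) 1 p) \<le> ennreal (2 * m)"
  proof (rule SUP_least)
    fix p assume "p \<in> presentations (target_mset m ?q)"
    then have same: "target_mset m p = target_mset m ?q" by (simp add: presentations_def size)
    have "p ` {..<m} = ?q ` {..<m}"
      using arg_cong[OF same, of set_mset] by (simp add: target_mset_def)
    then have targets: "p r = (\<infinity>, 1) \<or> p r = (ennreal ?x, 1)" if "r < m" for r
    proof -
      have "p r \<in> ?q ` {..<m}" using that \<open>p ` {..<m} = ?q ` {..<m}\<close> by blast
      then show ?thesis by (auto simp: two_level_def)
    qed
    let ?h = "history (sweep m ?x) p"
    have "\<exists>n\<le>k. 1 \<le> collected (?h n)"
    proof (rule ccontr)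
      assume "\<not> ?thesis"
      then have "\<forall>r<k. ennreal ?x < fst (p r)"
        using history_sweep[of k m ?x p] k targets by (fastforce simp: not_le)
      then have "p r = (\<infinity>, 1)" if "r < k" for r using targets[of r] that k by auto
      then have "{..<k} \<subseteq> {r\<in>{..<m}. p r = (\<infinity>, 1)}" using k by auto
      then have "k \<le> card {r\<in>{..<m}. p r = (\<infinity>, 1)}"
        using card_mono[of "{r\<in>{..<m}. p r = (\<infinity>, 1)}" "{..<k}"] by simp
      also have "\<dots> = card {r\<in>{..<m}. ?q r = (\<infinity>, 1)}" by (simp only: card_eq_target same)
      also have "{r\<in>{..<m}. ?q r = (\<infinity>, 1)} = Z" using Z by (auto simp: two_level_def)
      finally show False using Z by simp
    qed
    then obtain n where n: "n \<le> k" "1 \<le> collected (?h n)" by blast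
    define N where "N = (LEAST n. 1 \<le> collected (?h n))"
    have "N \<le> k" using n Least_le[of "\<lambda>n. 1 \<le> collected (?h n)" n] by (simp add: N_def)
    have "cost (sweep m ?x) 1 p = travelled (?h N)" using n by (auto simp: cost_def N_def)
    also have "\<dots> \<le> 2 * total (?h N)" by (rule travelled_le_total)
    also have "\<dots> \<le> 2 * (of_nat k * ennreal ?x)"
    proof (rule mult_left_mono)
      have "total (?h N) \<le> of_nat N * ennreal ?x" by (rule total_sweep_le)
      also have "\<dots> \<le> of_nat k * ennreal ?x" using \<open>N \<le> k\<close> by (intro mult_right_mono) auto
      finally show "total (?h N) \<le> of_nat k * ennreal ?x" .
    qed simp
    also have "\<dots> = ennreal 2 * ennreal (real k * ?x)"
      by (simp only: ennreal_of_nat_eq_real_of_nat ennreal_numeral ennreal_mult'[symmetric]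
          of_nat_0_le_iff)
    also have "\<dots> = ennreal (2 * m)"
      using k by (subst ennreal_mult[symmetric]) auto
    finally show "cost (sweep m ?x) 1 p \<le> ennreal (2 * m)" .
  qed
qed

lemma hard_instance:
  assumes "q \<in> hard_placements m"
  shows "(1, q) \<in> instances m"
proof -
  obtain k Z where q: "q = two_level m k Z" "k \<in> {1..m}"
    using assms by (auto simp: hard_placements_def)
  have snd: "snd (q i) = 1" for i by (simp add: q two_level_def)
  have "1 \<le> real m / real k" using q by simp
  then have "1 \<le> ennreal (real m / real k)" by (simp flip: ennreal_1 add: ennreal_leI)
  then have "1 \<le> fst (q i)" for i by (simp add: q two_level_def)
  with q(2) snd show ?thesis by (simp add: instances_def)
qed

section \<open>Online searchers that have found nothing\<close>

definition depth :: "trip list \<Rightarrow> nat \<Rightarrow> real" where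
  "depth h r = fold (\<lambda>(s, l, a) x. if s = r then max x l else x) h 0"

lemma depth_Nil: "depth [] r = 0"
  by (simp add: depth_def)

lemma depth_snoc: "depth (h @ [(s, l, a)]) r = (if s = r then max (depth h r) l else depth h r)"
  by (simp add: depth_def)

lemma depth_nonneg: "0 \<le> depth h r"
proof (induction h rule: rev_induct)
  case (snoc t h)
  then show ?case by (cases t) (auto simp: depth_snoc)
qed (simp add: depth_Nil)

lemma history_blank_Suc:
  assumes "\<sigma> (history \<sigma> blank n) = (r, l)"
  shows "history \<sigma> blank (Suc n) = history \<sigma> blank n @ [(r, l, None)]"
  using assms by (simp add: blank_def top_unique)

text \<open>As long as no ray is explored to its target, every answer is the same as on
  \<open>blank\<close>. Depths only grow, so the hypothesis passes down to shorter
  histories.\<close>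

lemma history_eq_blank:
  assumes "\<And>r. ennreal (depth (history \<sigma> blank n) r) < fst (q r)"
  shows "history \<sigma> q n = history \<sigma> blank n"
  using assms
proof (induction n)
  case (Suc n)
  obtain r l where rl: "\<sigma> (history \<sigma> blank n) = (r, l)" by fastforce
  note depth = depth_snoc[of "history \<sigma> blank n" r l None, folded history_blank_Suc[of \<sigma> n r l, OF rl]]
  have "ennreal (depth (history \<sigma> blank n) s) < fst (q s)" for s
    by (rule le_less_trans[OF _ Suc.prems[of s]]) (simp add: depth ennreal_leI del: history.simps)
  then have "history \<sigma> q n = history \<sigma> blank n" by (rule Suc.IH)
  moreover have "ennreal l < fst (q r)"
    by (rule le_less_trans[OF _ Suc.prems[of r]]) (simp add: depth ennreal_leI del: history.simps)
  ultimately show ?case unfolding history_blank_Suc[of \<sigma> n r l, OF rl] by (simp add: rl not_le)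
qed simp

lemma sum_depth_le_total:
  "ennreal (\<Sum>r<m. depth (history \<sigma> blank n) r) \<le> total (history \<sigma> blank n)"
proof (induction n)
  case (Suc n)
  obtain r l where rl: "\<sigma> (history \<sigma> blank n) = (r, l)" by fastforce
  let ?h = "history \<sigma> blank n"
  have "(\<Sum>s<m. depth (?h @ [(r, l, None)]) s) \<le> (\<Sum>s<m. depth ?h s + (if s = r then max 0 l else 0))"
    by (intro sum_mono) (auto simp: depth_snoc depth_nonneg intro: add_increasing)
  also have "\<dots> \<le> (\<Sum>s<m. depth ?h s) + max 0 l" by (simp add: sum.distrib)
  finally have "ennreal (\<Sum>s<m. depth (?h @ [(r, l, None)]) s)
      \<le> ennreal ((\<Sum>s<m. depth ?h s) + max 0 l)" by (rule ennreal_leI)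
  \<comment> \<open>\<open>ennreal\<close> sends negative depths to 0, in agreement with
    \<open>max 0 l\<close>.\<close>
  also have "\<dots> = ennreal (\<Sum>s<m. depth ?h s) + ennreal l"
    by (simp add: ennreal_plus sum_nonneg depth_nonneg max_def ennreal_neg)
  also have "\<dots> \<le> total ?h + ennreal l" using Suc by (rule add_right_mono)
  finally show ?case unfolding history_blank_Suc[of \<sigma> n r l, OF rl] by simp
qed (simp add: depth_Nil)

text \<open>While this fails for a fruitless search, some hard placement is still consistent with
  it.\<close>

definition saturated :: "nat \<Rightarrow> trip list \<Rightarrow> bool" where
  "saturated m h \<longleftrightarrow> (\<forall>k\<in>{1..m}. k \<le> card {r\<in>{..<m}. m / k \<le> depth h r})"

text \<open>In descending order, position \<open>j\<close> has depth at least
  \<open>m / (j + 1)\<close>: otherwise at most \<open>j\<close> rays reach that depth, against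
  saturation for \<open>k = j + 1\<close>. Truncating at \<open>m\<close> costs nothing here and
  later limits the effect of a single trip.\<close>

lemma saturated_imp_harmonic:
  assumes "saturated m h"
  shows "(\<Sum>j<m. m / (real j + 1)) \<le> (\<Sum>r<m. min (depth h r) m)"
proof -
  obtain f where f: "bij_betw f {..<m} {..<m}"
    and f_mono: "\<And>i j. i \<le> j \<Longrightarrow> j < m \<Longrightarrow> depth h (f j) \<le> depth h (f i)"
    using ex_descending_enumeration[of "{..<m}" "depth h"] by auto
  have "m / (real j + 1) \<le> min (depth h (f j)) m" if j: "j < m" for j
  proof -
    have "m / (real j + 1) \<le> depth h (f j)"
    proof (rule ccontr)
      assume less: "\<not> ?thesis"
      have "{r\<in>{..<m}. m / real (Suc j) \<le> depth h r} \<subseteq> f ` {..<j}"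
      proof
        fix r assume r: "r \<in> {r\<in>{..<m}. m / real (Suc j) \<le> depth h r}"
        then obtain i where i: "i < m" "r = f i" using f by (auto simp: bij_betw_def)
        have "\<not> j \<le> i" using f_mono[of j i] i r less by (auto simp: add.commute)
        then show "r \<in> f ` {..<j}" using i by auto
      qed
      then have "card {r\<in>{..<m}. m / real (Suc j) \<le> depth h r} \<le> card (f ` {..<j})"
        by (intro card_mono) auto
      also have "\<dots> \<le> j" using card_image_le[of "{..<j}" f] by simp
      finally show False using assms j unfolding saturated_def by (force dest: bspec[of _ _ "Suc j"])
    qed
    moreover have "m / (real j + 1) \<le> m" by (simp add: divide_le_eq algebra_simps)
    ultimately show ?thesis by simp
  qed
  then have "(\<Sum>j<m. m / (real j + 1)) \<le> (\<Sum>j<m. min (depth h (f j)) m)"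
    by (intro sum_mono) auto
  also have "\<dots> = (\<Sum>r<m. min (depth h r) m)" by (rule sum.reindex_bij_betw[OF f])
  finally show ?thesis .
qed

text \<open>The summand 1 will absorb the loss of one trip. The factor one half allows the step
  \<open>1 / m \<le> 2 / (m + 1)\<close>.\<close>

lemma harmonic_ge_ln: "1 \<le> m \<Longrightarrow> 1 + ln (real m) / 2 \<le> (\<Sum>j<m. 1 / (real j + 1))"
proof (induction m rule: nat_induct_at_least)
  case (Suc m)
  have "1 + 1 / real m = real (Suc m) / real m" using Suc.hyps by (simp add: field_simps)
  then have "ln (real (Suc m)) - ln (real m) = ln (1 + 1 / real m)"
    using Suc.hyps by (simp add: ln_div)
  also have "\<dots> \<le> 1 / real m" using Suc by (intro ln_add_one_self_le_self) simp
  also have "\<dots> \<le> 2 / (real m + 1)" using Suc by (simp add: field_simps)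
  finally have "ln (real (Suc m)) \<le> ln (real m) + 2 * (1 / (real m + 1))" by simp
  with Suc.IH show ?case by simp
qed simp

text \<open>If fewer than \<open>k\<close> rays were explored to depth \<open>m / k\<close>, those may be the empty ones.\<close>

lemma not_saturated_imp_hard_placement:
  assumes "\<not> saturated m (history \<sigma> blank n)"
  shows "\<exists>q\<in>hard_placements m. history \<sigma> q n = history \<sigma> blank n"
proof -
  let ?h = "history \<sigma> blank n"
  obtain k where k: "k \<in> {1..m}" "card {r\<in>{..<m}. m / k \<le> depth ?h r} < k"
    using assms by (auto simp: saturated_def not_le)
  let ?Z = "{r\<in>{..<m}. m / k \<le> depth ?h r}"
  have "history \<sigma> (two_level m k ?Z) n = ?h"
    by (rule history_eq_blank) (auto simp: two_level_def ennreal_less_iff depth_nonneg not_le)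
  moreover have "two_level m k ?Z \<in> hard_placements m"
    unfolding hard_placements_def using k by blast
  ultimately show ?thesis by blast
qed

lemma collected_blank: "collected (history \<sigma> blank n) = 0"
proof (induction n)
  case (Suc n)
  obtain r l where rl: "\<sigma> (history \<sigma> blank n) = (r, l)" by fastforce
  from history_blank_Suc[of \<sigma> n r l, OF rl] Suc show ?case by (simp add: collected_snoc del: history.simps)
qed (simp add: collected_def)

text \<open>If saturation never occurs, some hard placement is unfinished at each time, and as there
  are finitely many, one has infinite cost. Otherwise, just before the trip that saturates, a hard
  placement is still unfinished although the depths already sum up to nearly the harmonic
  bound.\<close>

lemma ex_costly_hard_placement:
  assumes m: "1 \<le> m"
  shows "\<exists>q\<in>hard_placements m. ennreal (m * (ln m / 2)) \<le> cost \<sigma> 1 q"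
proof -
  have nonneg: "0 \<le> snd (q i)" if "q \<in> hard_placements m" for q i
    using that by (auto simp: hard_placements_def two_level_def)
  let ?h = "history \<sigma> blank"
  show ?thesis
  proof (cases "\<exists>n. saturated m (?h n)")
    case False
    have "hard_placements m \<subseteq> (\<lambda>(k, Z). two_level m k Z) ` ({1..m} \<times> Pow {..<m})"
      by (force simp: hard_placements_def)
    then have "finite (hard_placements m)" by (rule finite_subset) simp
    moreover have "\<exists>q\<in>hard_placements m. collected (history \<sigma> q n) < 1" for n
      using not_saturated_imp_hard_placement[of m \<sigma> n] False collected_blank[of \<sigma> n] by force
    ultimately have "\<exists>q\<in>hard_placements m. cost \<sigma> 1 q = \<infinity>"
      by (intro cost_infinite_if_never_all_collected nonneg)
    then show ?thesis by force
  next
    case True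
    then obtain N where "saturated m (?h N)" by blast
    \<comment> \<open>For \<open>k = 1\<close> saturation needs a ray of depth \<open>m\<close>,
      which is positive.\<close>
    moreover have "\<not> saturated m (?h 0)"
      using m by (auto simp: saturated_def depth_Nil intro!: bexI[of _ 1])
    ultimately obtain n where n: "\<not> saturated m (?h n)" "saturated m (?h (Suc n))"
      using ex_least_nat_less[of "\<lambda>n. saturated m (?h n)" N] by blast
    obtain r l where rl: "\<sigma> (?h n) = (r, l)" by fastforce
    have "m * (1 + ln m / 2) \<le> m * (\<Sum>j<m. 1 / (real j + 1))"
      using harmonic_ge_ln[OF m] by (intro mult_left_mono) auto
    also have "\<dots> = (\<Sum>j<m. m / (real j + 1))" by (simp add: sum_distrib_left)
    also have "\<dots> \<le> (\<Sum>s<m. min (depth (?h (Suc n)) s) m)"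
      by (rule saturated_imp_harmonic[OF n(2)])
    \<comment> \<open>The saturating trip changes only ray \<open>r\<close>, where the truncated
      depth is at most \<open>m\<close>.\<close>
    also have "\<dots> \<le> (\<Sum>s<m. depth (?h n) s + (if s = r then real m else 0))"
      unfolding history_blank_Suc[of \<sigma> n r l, OF rl]
      by (intro sum_mono) (auto simp: depth_snoc depth_nonneg intro: add_increasing)
    also have "\<dots> \<le> (\<Sum>s<m. depth (?h n) s) + m" by (simp add: sum.distrib)
    finally have "m * (ln m / 2) \<le> (\<Sum>s<m. depth (?h n) s)" by (simp add: algebra_simps)
    then have "ennreal (m * (ln m / 2)) \<le> ennreal (\<Sum>s<m. depth (?h n) s)" by (rule ennreal_leI)
    also have "\<dots> \<le> total (?h n)" by (rule sum_depth_le_total)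
    also have "\<dots> \<le> travelled (?h n)" by (rule total_le_travelled)
    finally have costly: "ennreal (m * (ln m / 2)) \<le> travelled (?h n)" .
    obtain q where q: "q \<in> hard_placements m" "history \<sigma> q n = ?h n"
      using not_saturated_imp_hard_placement[OF n(1)] by blast
    have "ennreal (m * (ln m / 2)) \<le> cost \<sigma> 1 q"
    proof (rule cost_geI)
      show "collected (history \<sigma> q n) < 1" by (simp add: q collected_blank)
      have "travelled (?h n) \<le> travelled (history \<sigma> q (Suc n))"
        unfolding q(2)[symmetric] by (rule travelled_mono_history) simp
      with costly show "ennreal (m * (ln m / 2)) \<le> travelled (history \<sigma> q (Suc n))"
        by (rule order.trans)
    qed (rule nonneg[OF q(1)])
    with q(1) show ?thesis by blast
  qed
qed

lemma competitive_ratio_ge: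
  assumes "m \<ge> 2"
  shows "ennreal (1 / 4 * ln m) \<le> competitive_ratio m \<sigma>"
proof -
  obtain q where q: "q \<in> hard_placements m" "ennreal (m * (ln m / 2)) \<le> cost \<sigma> 1 q"
    using ex_costly_hard_placement[of m \<sigma>] assms by auto
  have le: "intrinsic_cost 1 (target_mset m q) \<le> ennreal (2 * m)"
    using q(1) intrinsic_cost_two_level by (auto simp: hard_placements_def)
  have "ennreal (1 / 4 * ln m) = ennreal (m * (ln m / 2)) / ennreal (2 * m)"
    using assms by (subst divide_ennreal) (auto simp: field_simps)
  also have "\<dots> \<le> cost \<sigma> 1 q / ennreal (2 * m)"
    using q(2) by (rule divide_right_mono_ennreal)
  also have "\<dots> \<le> cost \<sigma> 1 q / intrinsic_cost 1 (target_mset m q)"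
    unfolding divide_ennreal_def using le by (intro mult_left_mono ennreal_inverse_mono) auto
  also have "\<dots> \<le> competitive_ratio m \<sigma>"
    unfolding competitive_ratio_def using hard_instance[OF q(1)] by (rule SUP_upper2) simp
  finally show ?thesis .
qed

theorem theorem4:
  shows "(\<exists>C::real. C > 0 \<and>
            (\<forall>m\<ge>2. \<exists>\<sigma>. is_strategy m \<sigma> \<and> competitive_ratio m \<sigma> \<le> ennreal (C * ln (real m)))) \<and>
         (\<exists>c::real. c > 0 \<and>
            (\<forall>m\<ge>2. \<forall>\<sigma>. is_strategy m \<sigma> \<longrightarrow> ennreal (c * ln (real m)) \<le> competitive_ratio m \<sigma>))"
proof (intro conjI)
  show "\<exists>C::real. C > 0 \<and>
      (\<forall>m\<ge>2. \<exists>\<sigma>. is_strategy m \<sigma> \<and> competitive_ratio m \<sigma> \<le> ennreal (C * ln (real m)))"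
    using is_strategy_dovetail competitive_ratio_dovetail
    by (intro exI[of _ "32 / ln 2"]) auto
  show "\<exists>c::real. c > 0 \<and>
      (\<forall>m\<ge>2. \<forall>\<sigma>. is_strategy m \<sigma> \<longrightarrow> ennreal (c * ln (real m)) \<le> competitive_ratio m \<sigma>)"
    using competitive_ratio_ge by (intro exI[of _ "1 / 4"]) auto
qed

end
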